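(* Assume $\mu$ is strongly irreducible and contracting and satisfies (FE2) and (FE4), and $\mathbb E[\xi(\omega)]\neq0$. Then for every deterministic vector $x\in\mathbb R^d\setminus\{0\}$, \[ \lim_{n\to\infty}\frac1n\,\frac{\|T_n(\omega)x\|_2}{\|S_n(\omega)x\|_2}=|\mathbb E[\xi(\omega)]|\quad\text{a.s.} \]
   Context: Setup. Fix $d\ge 1$. Let $\lambda$ be a Borel probability measure on $GL(d,\mathbb R)\times M(d,\mathbb R)$, $\Omega=(GL(d,\mathbb R)\times M(d,\mathbb R))^{\mathbb Z}$ with $\mathbb P=\lambda^{\otimes\mathbb Z}$ and $\sigma$ the left shift. Write $\omega_0=(A(\omega),B(\omega))$, $A_n(\omega)=A(\sigma^{n-1}\omega)$, $B_n(\omega)=B(\sigma^{n-1}\omega)$, $n\in\mathbb Z$. $\mu$ is the law of $A_1$. $S_0=I$, $S_n=A_nS_{n-1}$; $T_0=0$, $T_n=B_nS_{n-1}+A_nT_{n-1}$. $S_n^*(\omega)=A_1^*\cdots A_n^*$ ($^*$ = transpose). $\|\cdot\|_2$: Euclidean norm. Strongly irreducible: no finite union of proper subspaces invariant under the closed semigroup $\mathcal S_\mu$ generated by the support of $\mu$. Contracting: some $M_n\in\mathcal S_\mu$ with $M_n/\|M_n\|$ converging to a rank one matrix. (FE2): $\mathbb E[\|B_1A_1^{-1}\|]<\infty$. (FE4): for some $\tau>0$, $\mathbb E[\exp(\tau\,\ell(A_1))]<\infty$, where $\ell(M)=\max\{\log^+\|M\|,\log^+\|M^{-1}\|\}$.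 Random directions $Z(\omega),\widetilde Z(\omega)\in\mathcal P(\mathbb R^d)$: a.s. every limit point of $S_n(\sigma^{-n}\omega)/\|S_n(\sigma^{-n}\omega)\|$ is rank one with range $Z(\omega)$, and every limit point of $S_n^*(\omega)/\|S_n^*(\omega)\|$ is rank one with range $\widetilde Z(\omega)$. $\xi(\omega)=\langle\widetilde z(\sigma\omega),B_1(\omega)z(\omega)\rangle/\langle\widetilde z(\sigma\omega),A_1(\omega)z(\omega)\rangle$ with any representatives $z(\omega)\in Z(\omega)$, $\widetilde z(\sigma\omega)\in\widetilde Z(\sigma\omega)$. Equivalently $\mathbb E[\xi]=\iiint\frac{\langle y,Bx\rangle}{\langle y,Ax\rangle}\,d\lambda(A,B)\,d\nu([x])\,d\nu^*([y])$ with $\nu$ the law of $Z$ and $\nu^*$ the law of $\widetilde Z$. *)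

theory Defs
  imports "HOL-Analysis.Analysis" "HOL-Probability.Probability"
begin

type_synonym 'd mat = "real^'d^'d"

text \<open>Coordinates: an element omega of Omega is a map int => (A,B).
  A_n(omega) = A(sigma^(n-1) omega) = fst (omega (n-1)), similarly B_n.\<close>

definition Acoef :: "(int \<Rightarrow> 'd mat \<times> 'd mat) \<Rightarrow> int \<Rightarrow> 'd::finite mat" where
  "Acoef \<omega> n = fst (\<omega> (n - 1))"

definition Bcoef :: "(int \<Rightarrow> 'd mat \<times> 'd mat) \<Rightarrow> int \<Rightarrow> 'd::finite mat" where
  "Bcoef \<omega> n = snd (\<omega> (n - 1))"

definition shift :: "int \<Rightarrow> (int \<Rightarrow> 'a) \<Rightarrow> (int \<Rightarrow> 'a)" where
  "shift m \<omega> = (\<lambda>i. \<omega> (i + m))"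

primrec Sprod :: "(int \<Rightarrow> 'd mat \<times> 'd mat) \<Rightarrow> nat \<Rightarrow> 'd::finite mat" where
  "Sprod \<omega> 0 = mat 1"
| "Sprod \<omega> (Suc n) = Acoef \<omega> (int (Suc n)) ** Sprod \<omega> n"

primrec Tprod :: "(int \<Rightarrow> 'd mat \<times> 'd mat) \<Rightarrow> nat \<Rightarrow> 'd::finite mat" where
  "Tprod \<omega> 0 = 0"
| "Tprod \<omega> (Suc n) = Bcoef \<omega> (int (Suc n)) ** Sprod \<omega> n + Acoef \<omega> (int (Suc n)) ** Tprod \<omega> n"

primrec Sstar :: "(int \<Rightarrow> 'd mat \<times> 'd mat) \<Rightarrow> nat \<Rightarrow> 'd::finite mat" where
  "Sstar \<omega> 0 = mat 1"
| "Sstar \<omega> (Suc n) = Sstar \<omega> n ** transpose (Acoef \<omega> (int (Suc n)))"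

definition limit_point :: "(nat \<Rightarrow> 'a::topological_space) \<Rightarrow> 'a \<Rightarrow> bool" where
  "limit_point f L \<longleftrightarrow> (\<exists>r. strict_mono r \<and> (f \<circ> r) \<longlonglongrightarrow> L)"

definition rank_one_limits_with_range :: "(nat \<Rightarrow> 'd::finite mat) \<Rightarrow> real^'d \<Rightarrow> bool" where
  "rank_one_limits_with_range f z \<longleftrightarrow>
     (\<forall>L. limit_point f L \<longrightarrow> rank L = 1 \<and> range (\<lambda>v. L *v v) = span {z})"

definition law_A :: "('d::finite mat \<times> 'd mat) measure \<Rightarrow> 'd mat measure" where
  "law_A lam = distr lam borel fst"

definition support_GL :: "'d::finite mat measure \<Rightarrow> 'd mat set" where
  "support_GL \<mu> = {M. invertible M \<and> (\<forall>e>0. emeasure \<mu> (ball M e) > 0)}"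

inductive_set gen_semigroup :: "'d::finite mat set \<Rightarrow> 'd mat set" for S where
  base: "M \<in> S \<Longrightarrow> M \<in> gen_semigroup S"
| mult: "M \<in> gen_semigroup S \<Longrightarrow> N \<in> gen_semigroup S \<Longrightarrow> M ** N \<in> gen_semigroup S"

definition closed_semigroup_GL :: "'d::finite mat measure \<Rightarrow> 'd mat set" where
  "closed_semigroup_GL \<mu> = closure (gen_semigroup (support_GL \<mu>)) \<inter> {M. invertible M}"

definition strongly_irreducible :: "'d::finite mat measure \<Rightarrow> bool" where
  "strongly_irreducible \<mu> \<longleftrightarrow>
     \<not> (\<exists>\<V>::(real^'d) set set. finite \<V> \<and> \<V> \<noteq> {} \<and>
           (\<forall>V\<in>\<V>. subspace V \<and> V \<noteq> {0} \<and> V \<noteq> UNIV) \<and>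
           (\<forall>M\<in>closed_semigroup_GL \<mu>. (\<lambda>v. M *v v) ` (\<Union>\<V>) = \<Union>\<V>))"

definition contracting :: "'d::finite mat measure \<Rightarrow> bool" where
  "contracting \<mu> \<longleftrightarrow>
     (\<exists>M::nat \<Rightarrow> 'd mat. \<exists>R. (\<forall>n. M n \<in> closed_semigroup_GL \<mu>) \<and> rank R = 1 \<and>
        (\<lambda>n. (1 / norm (M n)) *\<^sub>R M n) \<longlonglongrightarrow> R)"

definition logplus :: "real \<Rightarrow> real" where
  "logplus x = max 0 (ln x)"

definition ell :: "'d::finite mat \<Rightarrow> real" where
  "ell M = max (logplus (norm M)) (logplus (norm (matrix_inv M)))"

definition FE2 :: "('d::finite mat \<times> 'd mat) measure \<Rightarrow> bool" where
  "FE2 lam \<longleftrightarrow> integrable lam (\<lambda>p. norm (snd p ** matrix_inv (fst p)))"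

definition FE4 :: "('d::finite mat \<times> 'd mat) measure \<Rightarrow> bool" where
  "FE4 lam \<longleftrightarrow> (\<exists>\<tau>>0. integrable lam (\<lambda>p. exp (\<tau> * ell (fst p))))"

text \<open>xi(omega) for given representatives z(omega), zt(omega) of Z(omega), Z~(omega).\<close>
definition xi :: "((int \<Rightarrow> 'd mat \<times> 'd mat) \<Rightarrow> real^'d) \<Rightarrow> ((int \<Rightarrow> 'd mat \<times> 'd mat) \<Rightarrow> real^'d)
                  \<Rightarrow> (int \<Rightarrow> 'd mat \<times> 'd mat) \<Rightarrow> real" where
  "xi z zt \<omega> = (zt (shift 1 \<omega>) \<bullet> (Bcoef \<omega> 1 *v z \<omega>)) / (zt (shift 1 \<omega>) \<bullet> (Acoef \<omega> 1 *v z \<omega>))"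

end

theory Submission
  imports Defs "HOL-Real_Asymp.Real_Asymp"
begin

text \<open>
  Let \<open>a\<close> and \<open>b\<close> be the normalizations of \<open>z\<close> and \<open>zt\<close>, and let
  \<open>\<xi>\<^sub>k = \<xi>(\<sigma>\<^sup>k \<omega>)\<close>. By equivariance \<open>S\<^sub>k a\<close> is a multiple of \<open>a(\<sigma>\<^sup>k \<omega>)\<close>, and
  \<open>T\<^sub>n a - (\<Sum>k<n. \<xi>\<^sub>k) S\<^sub>n a\<close> is a sum of terms \<open>S\<^bsub>n-k-1\<^esub>(\<sigma>\<^bsup>k+1\<^esup> \<omega>) (B - \<xi>\<^sub>k A) S\<^sub>k a\<close>.
  Relative to the norm of \<open>S\<^sub>n a\<close> the term with index \<open>k\<close> is \<open>g\<^bsub>n-k-1\<^esub>(\<sigma>\<^sup>k \<omega>)\<close> for a fixed sequence \<open>g\<^sub>m\<close>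
  that tends to 0 almost surely, because \<open>(B - \<xi> A) a\<close> is orthogonal to \<open>b(\<sigma> \<omega>)\<close>.

  The point is that \<open>sup g\<^sub>m\<close> over \<open>m\<close> is integrable as soon as \<open>\<xi>\<close> is. A first-passage argument bounds the
  tail of \<open>sup \<parallel>S\<^sub>m B a\<parallel> / \<parallel>S\<^sub>m A a\<parallel>\<close> by a constant times the tail of its limit
  \<open>\<bar>\<langle>b, B a\<rangle>\<bar> / \<bar>\<langle>b, A a\<rangle>\<bar> = \<bar>\<xi>\<bar>\<close>, since the law of \<open>b\<close> gives no mass to hyperplanes. Birkhoff's theorem for
  \<open>\<xi>\<close>, together with a version for the diagonal averages of \<open>g\<close>, then gives
  \<open>(T\<^sub>n a / n - E[\<xi>] S\<^sub>n a) / \<parallel>S\<^sub>n\<parallel> \<longlonglongrightarrow> 0\<close>. Given the future, the vectors for which this holds form a subspace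
  which contains \<open>a\<close> almost surely, hence everything, because \<open>a\<close> depends only on the past and is not
  confined to a proper subspace. Integrability of \<open>\<xi>\<close> comes from its integral being nonzero.
\<close>

section \<open>Ergodic averages\<close>

locale ergodic_map = prob_space M for M :: "'a measure" +
  fixes T :: "'a \<Rightarrow> 'a"
  assumes T_measurable [measurable]: "T \<in> measurable M M"
    and T_preserves: "distr M M T = M"
    and T_ergodic: "\<And>A. A \<in> sets M \<Longrightarrow> T -` A \<inter> space M = A \<Longrightarrow> prob A = 0 \<or> prob A = 1"
begin

lemma AE_compose_T:
  assumes "AE x in M. Q x" shows "AE x in M. Q (T x)"
  by (rule AE_distrD[OF T_measurable]) (simp only: T_preserves assms)

lemma integrable_compose_T:
  fixes f :: "'a \<Rightarrow> real"
  assumes "integrable M f" shows "integrable M (\<lambda>x. f (T x))"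
  by (rule integrable_distr[OF T_measurable]) (simp only: T_preserves assms)

lemma integral_compose_T:
  fixes f :: "'a \<Rightarrow> real"
  assumes [measurable]: "f \<in> borel_measurable M" shows "(\<integral>x. f (T x) \<partial>M) = (\<integral>x. f x \<partial>M)"
  using integral_distr[OF T_measurable assms] by (simp only: T_preserves)

lemma funpow_measurable [measurable]: "(T ^^ n) \<in> measurable M M"
  by (induction n) (auto intro: measurable_comp)

lemma AE_compose_funpow:
  assumes "AE x in M. Q x" shows "AE x in M. \<forall>n. Q ((T ^^ n) x)"
proof -
  have "AE x in M. Q ((T ^^ n) x)" for n
  proof (induction n)
    case 0 then show ?case using assms by simp
  next
    case (Suc n)
    from AE_compose_T[OF this] show ?case by (simp add: funpow_swap1)
  qed
  then show ?thesis by (simp add: AE_all_countable)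
qed

text \<open>This is the maximum of the Birkhoff sums of lengths 0, ..., n. The recursion splits off
  the first summand, which is what relates the values at \<open>x\<close> and
  \<open>T x\<close>.\<close>

primrec max_sum :: "('a \<Rightarrow> real) \<Rightarrow> nat \<Rightarrow> 'a \<Rightarrow> real" where
  "max_sum f 0 x = 0"
| "max_sum f (Suc n) x = max 0 (f x + max_sum f n (T x))"

lemma max_sum_nonneg: "0 \<le> max_sum f n x"
  by (cases n) auto

lemma max_sum_mono_Suc: "max_sum f n x \<le> max_sum f (Suc n) x"
proof (induction n arbitrary: x)
  case 0 then show ?case by simp
next
  case (Suc n)
  have "f x + max_sum f n (T x) \<le> f x + max_sum f (Suc n) (T x)"
    using Suc[of "T x"] by simp
  then show ?case by (simp only: max_sum.simps)
qed

lemma max_sum_mono: "m \<le> n \<Longrightarrow> max_sum f m x \<le> max_sum f n x"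
  by (rule lift_Suc_mono_le[of "\<lambda>n. max_sum f n x"]) (auto intro: max_sum_mono_Suc simp del: max_sum.simps)

lemma sum_le_max_sum: "(\<Sum>i<n. f ((T ^^ i) x)) \<le> max_sum f n x"
proof (induction n arbitrary: x)
  case 0 then show ?case by simp
next
  case (Suc n)
  have "(\<Sum>i<Suc n. f ((T ^^ i) x)) = f x + (\<Sum>i<n. f ((T ^^ i) (T x)))"
    by (simp add: sum.lessThan_Suc_shift funpow_swap1 del: sum.lessThan_Suc)
  also have "\<dots> \<le> f x + max_sum f n (T x)"
    using Suc[of "T x"] by simp
  finally show ?case by simp
qed

lemma max_sum_integrable:
  fixes f :: "'a \<Rightarrow> real"
  assumes f: "integrable M f" shows "integrable M (max_sum f n)"
proof (induction n)
  case 0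
  have "max_sum f 0 = (\<lambda>x. 0)" by auto
  then show ?case by simp
next
  case (Suc n)
  have "integrable M (\<lambda>x. max 0 (f x + max_sum f n (T x)))"
    using integrable_compose_T[OF Suc] f by simp
  moreover have "max_sum f (Suc n) = (\<lambda>x. max 0 (f x + max_sum f n (T x)))" by auto
  ultimately show ?case by simp
qed

text \<open>The set \<open>A\<close> where the maximal sums are unbounded is strictly invariant, so
  it has probability 0 or 1. Probability 1 is impossible: the differences
  \<open>max_sum f (Suc n) x - max_sum f n (T x)\<close> have nonnegative integral by invariance of
  the measure and monotonicity in n, and they would converge almost surely to \<open>f\<close>,
  dominated by its absolute value, so that E f \<ge> 0.\<close>

lemma birkhoff_sums_bounded_above:
  fixes f :: "'a \<Rightarrow> real"
  assumes f: "integrable M f" and neg: "expectation f < 0"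
  shows "AE x in M. \<exists>K. \<forall>n. (\<Sum>i<n. f ((T ^^ i) x)) \<le> K"
proof -
  have fm [measurable]: "f \<in> borel_measurable M" using f by auto
  have Mm [measurable]: "max_sum f n \<in> borel_measurable M" for n
    using max_sum_integrable[OF f] by auto
  define A where "A = {x\<in>space M. \<forall>k::nat. \<exists>n. max_sum f n x > real k}"
  have A_sets [measurable]: "A \<in> sets M" unfolding A_def by measurable
  have A_iff: "x \<in> A \<longleftrightarrow> x \<in> space M \<and> (\<forall>K. \<exists>n. max_sum f n x > K)" for x
  proof -
    have "\<exists>n. max_sum f n x > K" if "\<forall>k::nat. \<exists>n. max_sum f n x > real k" for K
      using that real_arch_simple[of K] by (meson order.strict_trans1)
    then show ?thesis unfolding A_def by auto
  qed
  have Tsp: "T x \<in> space M" if "x \<in> space M" for x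
    using measurable_space[OF T_measurable that] .
  have inv: "T x \<in> A \<longleftrightarrow> x \<in> A" if x: "x \<in> space M" for x
  proof
    assume Tx: "T x \<in> A"
    show "x \<in> A" unfolding A_iff
    proof (intro conjI allI)
      fix K
      obtain n where "max_sum f n (T x) > K - f x" using Tx unfolding A_iff by blast
      then have "max_sum f (Suc n) x > K" by simp
      then show "\<exists>n. max_sum f n x > K" by blast
    qed (rule x)
  next
    assume xA: "x \<in> A"
    show "T x \<in> A" unfolding A_iff
    proof (intro conjI allI)
      fix K
      \<comment> \<open>The maximum with 0 forces \<open>n\<close> to be positive, since
        \<open>max_sum f 0 x\<close> is 0; so the recursion can be unfolded.\<close>
      obtain n where n: "max_sum f n x > max 0 (f x + K)" using xA unfolding A_iff by blast
      then obtain m where "n = Suc m" by (cases n) auto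
      with n have "max_sum f m (T x) > K" by auto
      then show "\<exists>n. max_sum f n (T x) > K" by blast
    qed (rule Tsp[OF x])
  qed
  have "T -` A \<inter> space M = A" using inv unfolding A_def by auto
  from T_ergodic[OF A_sets this] have "prob A = 0"
  proof
    assume A1: "prob A = 1"
    then have AEA: "AE x in M. x \<in> A" by (simp add: prob_eq_1)
    \<comment> \<open>This form shows the bound by the absolute value of \<open>f\<close> and the
      eventual equality with \<open>f\<close>; the form in \<open>D_eq\<close> gives the sign of the
      integral.\<close>
    define D where "D = (\<lambda>n x. max (f x) (- max_sum f n (T x)))"
    have Dm [measurable]: "D n \<in> borel_measurable M" for n unfolding D_def by measurable
    have D_eq: "D n x = max_sum f (Suc n) x - max_sum f n (T x)" for n x
      unfolding D_def by (simp add: max_def)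
    have lim: "(\<lambda>n. expectation (D n)) \<longlonglongrightarrow> expectation f"
    proof (rule integral_dominated_convergence[where w="\<lambda>x. \<bar>f x\<bar>"])
      show "AE x in M. (\<lambda>n. D n x) \<longlonglongrightarrow> f x"
        using AE_compose_T[OF AEA]
      proof eventually_elim
        case (elim x)
        obtain N where N: "max_sum f N (T x) > - f x" using elim unfolding A_iff by blast
        have "D n x = f x" if "n \<ge> N" for n
          using max_sum_mono[OF that, of f "T x"] N unfolding D_def by auto
        then show ?case by (intro tendsto_eventually) (auto simp: eventually_sequentially)
      qed
      show "AE x in M. norm (D n x) \<le> \<bar>f x\<bar>" for n
        unfolding D_def using max_sum_nonneg[of f n] by (intro AE_I2) (smt (verit) real_norm_def)
    qed (use f in auto)
    have "expectation (D n) \<ge> 0" for n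
    proof -
      have "expectation (D n) = expectation (max_sum f (Suc n)) - (\<integral>x. max_sum f n (T x) \<partial>M)"
        unfolding D_eq
        by (intro Bochner_Integration.integral_diff max_sum_integrable[OF f] integrable_compose_T[OF max_sum_integrable[OF f]])
      also have "(\<integral>x. max_sum f n (T x) \<partial>M) = expectation (max_sum f n)"
        by (rule integral_compose_T) measurable
      finally show ?thesis
        using integral_mono[OF max_sum_integrable[OF f] max_sum_integrable[OF f] max_sum_mono_Suc[of f n]]
        by simp
    qed
    then have "expectation f \<ge> 0" by (intro LIMSEQ_le_const[OF lim]) auto
    with neg show ?thesis by simp
  qed
  then have "AE x in M. x \<notin> A" by (simp add: prob_eq_0)
  then show ?thesis
  proof (rule AE_mp, intro AE_I2 impI)
    fix x assume "x \<in> space M" "x \<notin> A"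
    then obtain K where "\<forall>n. max_sum f n x \<le> K" unfolding A_iff by (auto simp: not_less)
    then show "\<exists>K. \<forall>n. (\<Sum>i<n. f ((T ^^ i) x)) \<le> K"
      using sum_le_max_sum[of f x] by (meson order_trans)
  qed
qed

text \<open>Both \<open>f\<close> and its negative are centered and lowered by 1/(j+1), which makes
  the expectations negative; partial sums bounded above leave no positive contribution after
  division by n. Countably many j serve every tolerance.\<close>

theorem birkhoff:
  fixes f :: "'a \<Rightarrow> real"
  assumes f: "integrable M f"
  shows "AE x in M. (\<lambda>n. (\<Sum>i<n. f ((T ^^ i) x)) / real n) \<longlonglongrightarrow> expectation f"
proof -
  let ?E = "expectation f"
  have up: "AE x in M. \<forall>j::nat. \<exists>K. \<forall>n. (\<Sum>i<n. f ((T ^^ i) x) - ?E - 1 / real (Suc j)) \<le> K"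
    unfolding AE_all_countable
  proof
    fix j :: nat
    have "expectation (\<lambda>x. f x - ?E - 1 / real (Suc j)) < 0"
      using f by (simp add: prob_space)
    then show "AE x in M. \<exists>K. \<forall>n. (\<Sum>i<n. f ((T ^^ i) x) - ?E - 1 / real (Suc j)) \<le> K"
      by (intro birkhoff_sums_bounded_above) (use f in auto)
  qed
  have lo: "AE x in M. \<forall>j::nat. \<exists>K. \<forall>n. (\<Sum>i<n. ?E - f ((T ^^ i) x) - 1 / real (Suc j)) \<le> K"
    unfolding AE_all_countable
  proof
    fix j :: nat
    have "expectation (\<lambda>x. ?E - f x - 1 / real (Suc j)) < 0"
      using f by (simp add: prob_space)
    then show "AE x in M. \<exists>K. \<forall>n. (\<Sum>i<n. ?E - f ((T ^^ i) x) - 1 / real (Suc j)) \<le> K"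
      by (intro birkhoff_sums_bounded_above) (use f in auto)
  qed
  show ?thesis using up lo
  proof eventually_elim
    case (elim x)
    define s where "s n = (\<Sum>i<n. f ((T ^^ i) x))" for n
    have "\<exists>N. \<forall>n\<ge>N. \<bar>s n / real n - ?E\<bar> < e" if e: "e > 0" for e
    proof -
      obtain j where j: "1 / real (Suc j) < e / 2"
        using e by (metis half_gt_zero nat_approx_posE)
      obtain K1 where K1: "\<And>n. (\<Sum>i<n. f ((T ^^ i) x) - ?E - 1 / real (Suc j)) \<le> K1" using elim by blast
      obtain K2 where K2: "\<And>n. (\<Sum>i<n. ?E - f ((T ^^ i) x) - 1 / real (Suc j)) \<le> K2" using elim by blast
      define K where "K = max 1 (max K1 K2)"
      obtain N :: nat where N: "real N > 2 * K / e" using reals_Archimedean2 by blast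
      have Kpos: "K \<ge> 1" unfolding K_def by simp
      show ?thesis
      proof (intro exI[of _ N] allI impI)
        fix n assume n: "n \<ge> N"
        have nN: "real n > 2 * K / e" using N n by simp
        then have npos: "real n > 0" using Kpos e by (smt (verit) divide_nonneg_pos)
        have Kn: "K < real n * (e / 2)" using nN e by (simp add: field_simps)
        have a1: "s n - n * ?E - n * (1 / real (Suc j)) \<le> K"
          using K1[of n] unfolding s_def K_def by (simp add: sum_subtractf)
        have a2: "n * ?E - s n - n * (1 / real (Suc j)) \<le> K"
          using K2[of n] unfolding s_def K_def by (simp add: sum_subtractf)
        have "n * (1 / real (Suc j)) < n * (e / 2)" using j npos by (intro mult_strict_left_mono) auto
        then have "\<bar>s n - n * ?E\<bar> < n * (e/2) + n * (e/2)" using a1 a2 Kn unfolding abs_less_iff by linarith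
        then have "\<bar>s n - n * ?E\<bar> < e * n" by (simp add: mult.commute)
        moreover have "s n / real n - ?E = (s n - n * ?E) / n" using npos by (simp add: field_simps)
        ultimately show "\<bar>s n / real n - ?E\<bar> < e" using npos by (simp add: abs_divide pos_divide_less_eq)
      qed
    qed
    then show ?case unfolding s_def by (simp add: LIMSEQ_iff)
  qed
qed

text \<open>Function and orbit point vary together, so Birkhoff's theorem does not apply directly.
  Terms with index at least K are dominated by the tail supremum \<open>H K\<close>, whose averages
  tend to its expectation, and that expectation tends to 0 as K grows. The last K terms are
  dominated by \<bar>G\<bar> along a window of fixed length, whose share of the average vanishes by
  Birkhoff's theorem for \<bar>G\<bar>.\<close>

lemma diagonal_average_tendsto_0:
  fixes g :: "nat \<Rightarrow> 'a \<Rightarrow> real"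
  assumes g_measurable [measurable]: "\<And>m. g m \<in> borel_measurable M"
    and g_nonneg: "\<And>m x. 0 \<le> g m x"
    and g_lim: "AE x in M. (\<lambda>m. g m x) \<longlonglongrightarrow> 0"
    and g_le: "AE x in M. \<forall>m. g m x \<le> G x"
    and G: "integrable M G"
  shows "AE x in M. (\<lambda>n. (\<Sum>k<n. g (n - Suc k) ((T ^^ k) x)) / real n) \<longlonglongrightarrow> 0"
proof -
  have [measurable]: "G \<in> borel_measurable M" using G by auto
  \<comment> \<open>Truncation makes the suprema below finite at every point; along almost every
    orbit \<open>h\<close> agrees with \<open>g\<close>.\<close>
  define h where "h m x = min (g m x) \<bar>G x\<bar>" for m x
  have [measurable]: "h m \<in> borel_measurable M" for m unfolding h_def by measurable
  have h_bounds: "0 \<le> h m x" "h m x \<le> \<bar>G x\<bar>" for m x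
    using g_nonneg[of m x] by (auto simp: h_def)
  have bdd: "bdd_above (range (\<lambda>m. h (K + m) x))" for K x
    by (rule bdd_aboveI[of _ "\<bar>G x\<bar>"]) (use h_bounds in auto)
  define H where "H K x = (SUP m. h (K + m) x)" for K x
  have [measurable]: "H K \<in> borel_measurable M" for K
    unfolding H_def by (intro borel_measurable_cSUP) (use bdd in auto)
  have H_upper: "h m x \<le> H K x" if "m \<ge> K" for K m x
    unfolding H_def using cSUP_upper[OF UNIV_I bdd[of K x], of "m - K"] that by simp
  have H_nonneg: "0 \<le> H K x" for K x
    using H_upper[of K K x] h_bounds(1)[of K x] by simp
  have H_le: "H K x \<le> \<bar>G x\<bar>" for K x
    unfolding H_def by (intro cSUP_least) (use h_bounds in auto)
  have H_int: "integrable M (H K)" for K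
    by (rule Bochner_Integration.integrable_bound[OF G]) (use H_nonneg H_le in auto)
  have "(\<lambda>K. expectation (H K)) \<longlonglongrightarrow> (\<integral>x. 0 \<partial>M)"
  proof (rule integral_dominated_convergence[where w="\<lambda>x. \<bar>G x\<bar>"])
    show "AE x in M. (\<lambda>K. H K x) \<longlonglongrightarrow> 0"
      using g_lim
    proof eventually_elim
      case (elim x)
      show ?case
      proof (rule LIMSEQ_I)
        fix e :: real assume e: "e > 0"
        obtain N where N: "\<And>m. m \<ge> N \<Longrightarrow> \<bar>g m x\<bar> < e / 2"
          using LIMSEQ_D[OF elim, of "e/2"] e by auto
        have "norm (H K x - 0) < e" if "K \<ge> N" for K
        proof -
          have "H K x \<le> e / 2" unfolding H_def
          proof (rule cSUP_least)
            fix m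
            have "\<bar>g (K + m) x\<bar> < e / 2" using N[of "K + m"] that by simp
            then show "h (K + m) x \<le> e / 2" by (auto simp: h_def)
          qed simp
          then show ?thesis using H_nonneg[of K x] e by simp
        qed
        then show "\<exists>no. \<forall>n\<ge>no. norm (H n x - 0) < e" by blast
      qed
    qed
    show "AE x in M. norm (H K x) \<le> \<bar>G x\<bar>" for K
      using H_nonneg H_le by auto
  qed (use G in auto)
  then have EH: "(\<lambda>K. expectation (H K)) \<longlonglongrightarrow> 0" by simp
  have "AE x in M. \<forall>K. (\<lambda>n. (\<Sum>i<n. H K ((T ^^ i) x)) / real n) \<longlonglongrightarrow> expectation (H K)"
    unfolding AE_all_countable using birkhoff[OF H_int] by auto
  moreover have "AE x in M. (\<lambda>n. (\<Sum>i<n. \<bar>G ((T ^^ i) x)\<bar>) / real n) \<longlonglongrightarrow> expectation (\<lambda>x. \<bar>G x\<bar>)"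
    using birkhoff[of "\<lambda>x. \<bar>G x\<bar>"] G by simp
  moreover have "AE x in M. \<forall>i m. g m ((T ^^ i) x) \<le> G ((T ^^ i) x)"
    by (rule AE_compose_funpow[OF g_le])
  ultimately show ?thesis
  proof eventually_elim
    case (elim x)
    define s where "s n = (\<Sum>i<n. \<bar>G ((T ^^ i) x)\<bar>)" for n
    define a where "a n = (\<Sum>k<n. g (n - Suc k) ((T ^^ k) x)) / real n" for n
    have a_nonneg: "0 \<le> a n" for n unfolding a_def by (auto intro!: sum_nonneg divide_nonneg_nonneg g_nonneg)
    have gh: "g m ((T ^^ i) x) = h m ((T ^^ i) x)" for i m
      using elim(3)[rule_format, of m i] unfolding h_def by auto
    show ?case unfolding a_def[symmetric]
    proof (rule LIMSEQ_I)
      fix e :: real assume e: "e > 0"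
      obtain K where K: "expectation (H K) < e"
        using LIMSEQ_D[OF EH e] by (auto simp: abs_less_iff)
      \<comment> \<open>At time \<open>n + K\<close> the terms with k < n have index at least K and
        are bounded by \<open>H K\<close>; the other K terms are bounded by the increment of
        \<open>s\<close>.\<close>
      define b where "b n = (\<Sum>i<n + K. H K ((T ^^ i) x)) / real (n + K) + (s (n + K) - s n) / real (n + K)" for n
      have ratio: "(\<lambda>n. real n / real (n + K)) \<longlonglongrightarrow> 1"
        using LIMSEQ_n_over_Suc_n by real_asymp
      have "(\<lambda>n. s (n + K) / real (n + K) - s n / real n * (real n / real (n + K)))
          \<longlonglongrightarrow> expectation (\<lambda>x. \<bar>G x\<bar>) - expectation (\<lambda>x. \<bar>G x\<bar>) * 1"
        using elim(2) unfolding s_def[symmetric]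
        by (intro tendsto_diff tendsto_mult ratio LIMSEQ_ignore_initial_segment) auto
      moreover have "s n / real n * (real n / real (n + K)) = s n / real (n + K)" for n
        by (cases "n = 0") (auto simp: s_def)
      ultimately have "(\<lambda>n. (s (n + K) - s n) / real (n + K)) \<longlonglongrightarrow> 0"
        by (simp only: diff_divide_distrib mult_1_right diff_self)
      then have "b \<longlonglongrightarrow> expectation (H K) + 0" unfolding b_def
        by (intro tendsto_add LIMSEQ_ignore_initial_segment elim(1)[rule_format])
      then have "eventually (\<lambda>n. b n < e) sequentially"
        using K by (intro order_tendstoD(2)) auto
      then obtain N where N: "\<And>n. n \<ge> N \<Longrightarrow> b n < e" by (auto simp: eventually_sequentially)
      have ab: "a (n + K) \<le> b n" for n
      proof -
        let ?t = "\<lambda>k. g (n + K - Suc k) ((T ^^ k) x)"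
        have "(\<Sum>k<n + K. ?t k) = (\<Sum>k<n. ?t k) + (\<Sum>k=n..<n+K. ?t k)"
          unfolding lessThan_atLeast0 by (rule sum.atLeastLessThan_concat[symmetric]) auto
        also have "(\<Sum>k<n. ?t k) \<le> (\<Sum>k<n. H K ((T ^^ k) x))"
          by (intro sum_mono) (auto simp: gh intro!: H_upper)
        also have "\<dots> \<le> (\<Sum>k<n + K. H K ((T ^^ k) x))"
          by (intro sum_mono2) (use H_nonneg in auto)
        also have "(\<Sum>k=n..<n+K. ?t k) \<le> (\<Sum>k=n..<n+K. \<bar>G ((T ^^ k) x)\<bar>)"
          by (intro sum_mono) (auto simp: gh intro!: h_bounds)
        also have "\<dots> = s (n + K) - s n"
        proof -
          have "s (n + K) = s n + (\<Sum>k=n..<n+K. \<bar>G ((T ^^ k) x)\<bar>)"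
            unfolding s_def lessThan_atLeast0 by (rule sum.atLeastLessThan_concat[symmetric]) auto
          then show ?thesis by simp
        qed
        finally show ?thesis unfolding a_def b_def add_divide_distrib[symmetric]
          by (intro divide_right_mono) auto
      qed
      show "\<exists>no. \<forall>n\<ge>no. norm (a n - 0) < e"
      proof (intro exI[of _ "N + K"] allI impI)
        fix n assume "n \<ge> N + K"
        then have "a n \<le> b (n - K)" "b (n - K) < e" using ab[of "n - K"] N[of "n - K"] by auto
        then have "a n < e" by simp
        then show "norm (a n - 0) < e" using a_nonneg[of n] by simp
      qed
    qed
  qed
qed

end

text \<open>Layer-cake formula: Fubini for the region below the graph of \<open>F\<close>. The
  condition \<open>0 \<le> t\<close> stays inside the set because \<open>lborel\<close> covers all
  reals and \<open>ennreal\<close> sends negative ones to 0.\<close>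

lemma (in sigma_finite_measure) nn_integral_eq_tail_integral:
  fixes F :: "'a \<Rightarrow> ennreal"
  assumes [measurable]: "F \<in> borel_measurable M"
  shows "(\<integral>\<^sup>+x. F x \<partial>M)
    = (\<integral>\<^sup>+t. emeasure M {x\<in>space M. 0 \<le> t \<and> ennreal t < F x} \<partial>lborel)"
proof -
  interpret L: pair_sigma_finite M lborel ..
  let ?f = "\<lambda>x t. indicator {p\<in>space (M \<Otimes>\<^sub>M lborel). 0 \<le> snd p \<and> ennreal (snd p) < F (fst p)} (x, t) :: ennreal"
  have "(\<integral>\<^sup>+t. ?f x t \<partial>lborel) = F x" if x: "x \<in> space M" for x
  proof -
    have "(\<integral>\<^sup>+t. ?f x t \<partial>lborel) = (\<integral>\<^sup>+t. indicator {t. 0 \<le> t \<and> ennreal t < F x} t \<partial>lborel)"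
      by (intro nn_integral_cong) (auto simp: indicator_def space_pair_measure x)
    also have "\<dots> = emeasure lborel {t. 0 \<le> t \<and> ennreal t < F x}"
      by (intro nn_integral_indicator) measurable
    also have "\<dots> = F x"
    proof (cases "F x")
      case (real r)
      then have "{t. 0 \<le> t \<and> ennreal t < F x} = {0..<r}" by (auto simp: ennreal_less_iff)
      with real show ?thesis by simp
    next
      case top
      then have "{t. 0 \<le> t \<and> ennreal t < F x} = {0..}" by auto
      moreover have "emeasure lborel {0::real..} = \<infinity>"
      proof (rule ccontr)
        assume "emeasure lborel {0::real..} \<noteq> \<infinity>"
        then obtain n where n: "emeasure lborel {0::real..} < of_nat n"
          using ennreal_Ex_less_of_nat by (auto simp: less_top)
        have "of_nat n = emeasure lborel {0..<real n}" by (simp add: ennreal_of_nat_eq_real_of_nat)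
        also have "\<dots> \<le> emeasure lborel {0::real..}" by (intro emeasure_mono) auto
        finally show False using n by simp
      qed
      ultimately show ?thesis using top by simp
    qed
    finally show ?thesis .
  qed
  then have "(\<integral>\<^sup>+x. F x \<partial>M) = (\<integral>\<^sup>+x. (\<integral>\<^sup>+t. ?f x t \<partial>lborel) \<partial>M)"
    by (intro nn_integral_cong) simp
  also have "\<dots> = (\<integral>\<^sup>+t. (\<integral>\<^sup>+x. ?f x t \<partial>M) \<partial>lborel)"
    by (rule L.Fubini'[symmetric]) measurable
  also have "\<dots> = (\<integral>\<^sup>+t. emeasure M {x\<in>space M. 0 \<le> t \<and> ennreal t < F x} \<partial>lborel)"
  proof (intro nn_integral_cong)
    fix t :: real
    have "(\<integral>\<^sup>+x. ?f x t \<partial>M) = (\<integral>\<^sup>+x. indicator {x\<in>space M. 0 \<le> t \<and> ennreal t < F x} x \<partial>M)"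
      by (intro nn_integral_cong) (auto simp: indicator_def space_pair_measure)
    also have "\<dots> = emeasure M {x\<in>space M. 0 \<le> t \<and> ennreal t < F x}"
      by (intro nn_integral_indicator) measurable
    finally show "(\<integral>\<^sup>+x. ?f x t \<partial>M) = emeasure M {x\<in>space M. 0 \<le> t \<and> ennreal t < F x}" .
  qed
  finally show ?thesis .
qed

lemma (in sigma_finite_measure) nn_integral_le_if_tail_le:
  fixes F R :: "'a \<Rightarrow> ennreal"
  assumes [measurable]: "F \<in> borel_measurable M" "R \<in> borel_measurable M"
    and tail: "\<And>t::real. 0 \<le> t \<Longrightarrow>
      emeasure M {x\<in>space M. ennreal t < F x} \<le> C * emeasure M {x\<in>space M. ennreal t < R x}"
  shows "(\<integral>\<^sup>+x. F x \<partial>M) \<le> C * (\<integral>\<^sup>+x. R x \<partial>M)"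
proof -
  have "(\<integral>\<^sup>+x. F x \<partial>M) \<le> (\<integral>\<^sup>+t. C * emeasure M {x\<in>space M. 0 \<le> t \<and> ennreal t < R x} \<partial>lborel)"
    unfolding nn_integral_eq_tail_integral[OF assms(1)]
  proof (intro nn_integral_mono)
    fix t :: real
    show "emeasure M {x\<in>space M. 0 \<le> t \<and> ennreal t < F x} \<le> C * emeasure M {x\<in>space M. 0 \<le> t \<and> ennreal t < R x}"
      using tail[of t] by (cases "0 \<le> t") auto
  qed
  also have "\<dots> = C * (\<integral>\<^sup>+x. R x \<partial>M)"
    unfolding nn_integral_eq_tail_integral[OF assms(2)] by (intro nn_integral_cmult) measurable
  finally show ?thesis .
qed

text \<open>A function bounded by its own mean has no room to deviate from it. This turns maximality
  and stationarity into almost sure equality in \<open>b_nonorthogonal\<close>.\<close>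

lemma (in prob_space) AE_eq_of_nn_integral_eq:
  fixes f :: "'a \<Rightarrow> real"
  assumes [measurable]: "f \<in> borel_measurable M" and f: "\<And>x. 0 \<le> f x" and le: "AE x in M. f x \<le> c"
    and eq: "(\<integral>\<^sup>+x. f x \<partial>M) = ennreal c" and c: "0 \<le> c"
  shows "AE x in M. f x = c"
proof -
  have int: "integrable M f"
    by (rule integrableI_bounded) (use eq f in auto)
  then have "expectation f = c"
    using nn_integral_eq_integral[OF int] eq f c by (simp add: integral_nonneg_AE)
  then have "(\<integral>x. c - f x \<partial>M) = 0" using int prob_space by simp
  moreover have "integrable M (\<lambda>x. c - f x)" using int by simp
  moreover have "AE x in M. 0 \<le> c - f x" using le by simp
  ultimately have "AE x in M. c - f x = 0" using integral_nonneg_eq_0_iff_AE by blast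
  then show ?thesis by eventually_elim simp
qed

section \<open>The Bernoulli shift\<close>

text \<open>The past of \<omega> before time \<open>m\<close> followed by the future of \<omega>'.
  Independence of past and future is expressed through this map, by integrating over two independent
  samples instead of conditioning.\<close>

definition glue :: "int \<Rightarrow> (int \<Rightarrow> 'a) \<Rightarrow> (int \<Rightarrow> 'a) \<Rightarrow> int \<Rightarrow> 'a" where
  "glue m \<omega> \<omega>' = (\<lambda>i. if i < m then \<omega> i else \<omega>' i)"

lemma glue_less [simp]: "i < m \<Longrightarrow> glue m \<omega> \<omega>' i = \<omega> i"
  and glue_ge [simp]: "m \<le> i \<Longrightarrow> glue m \<omega> \<omega>' i = \<omega>' i"
  by (auto simp: glue_def)

lemma shift_0 [simp]: "shift 0 \<omega> = \<omega>"
  by (simp add: shift_def)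

lemma shift_shift [simp]: "shift m (shift n \<omega>) = shift (m + n) \<omega>"
  by (simp add: shift_def ac_simps)

lemma shift_funpow: "(shift 1 ^^ n) \<omega> = shift (int n) \<omega>"
  by (induction n) (auto simp: add.commute)

locale iid_sequence =
  fixes lam :: "'a measure"
  assumes prob_lam: "prob_space lam" and space_lam: "space lam = UNIV"
begin

definition P :: "(int \<Rightarrow> 'a) measure" where "P = PiM UNIV (\<lambda>_. lam)"

sublocale PP: product_prob_space "\<lambda>_::int. lam" UNIV
  by (simp add: prob_lam product_prob_spaceI)

sublocale P: prob_space P
  unfolding P_def by (rule PP.P.prob_space_axioms)

sublocale PPP: pair_prob_space P P ..

lemma space_P [simp]: "space P = UNIV"
  by (simp add: P_def space_PiM space_lam)

lemma coordinate_measurable [measurable]: "(\<lambda>\<omega>. \<omega> i) \<in> measurable P lam"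
  unfolding P_def by measurable

lemma measurable_into_P:
  assumes "\<And>i. (\<lambda>x. f x i) \<in> measurable N lam" shows "f \<in> measurable N P"
  unfolding P_def by (rule measurable_PiM_single') (use assms in \<open>auto simp: space_lam PiE_iff\<close>)

lemma shift_measurable [measurable]: "shift m \<in> measurable P P"
  by (rule measurable_into_P) (simp add: shift_def)

lemma glue_measurable [measurable]: "(\<lambda>(\<omega>, \<omega>'). glue m \<omega> \<omega>') \<in> measurable (P \<Otimes>\<^sub>M P) P"
  by (rule measurable_into_P) (auto simp: glue_def split_beta')

lemma glue_measurable_Pair [measurable (raw)]:
  assumes "f \<in> measurable N P" "g \<in> measurable N P"
  shows "(\<lambda>x. glue m (f x) (g x)) \<in> measurable N P"
  using measurable_compose[OF measurable_Pair[OF assms] glue_measurable] by simp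

lemma distr_shift: "distr P P (shift m) = P"
proof -
  have "(shift m :: (int \<Rightarrow> 'a) \<Rightarrow> _) = (\<lambda>\<omega> n. \<omega> (n + m))" by (simp add: shift_def fun_eq_iff)
  then show ?thesis
    using distr_PiM_reindex[of UNIV "\<lambda>_::int. lam" "\<lambda>i. i + m" UNIV] prob_lam
    by (simp add: P_def inj_on_def restrict_UNIV)
qed

text \<open>A product measure is determined by finite boxes. The preimage of a box under gluing is a
  rectangle: the constraints before \<open>m\<close> concern the first sample, the remaining ones
  the second, and the two products of probabilities recombine.\<close>

lemma distr_glue: "distr (P \<Otimes>\<^sub>M P) P (\<lambda>(\<omega>, \<omega>'). glue m \<omega> \<omega>') = P" (is "?D = _")
proof -
  let ?f = "\<lambda>(\<omega>, \<omega>'). glue m \<omega> \<omega>'"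
  have "?D = PiM UNIV (\<lambda>_::int. lam)"
  proof (rule PP.PiM_eq)
    fix J :: "int set" and E assume J: "finite J" "J \<subseteq> UNIV" "\<And>j. j \<in> J \<Longrightarrow> E j \<in> sets lam"
    let ?X = "\<lambda>J. prod_emb UNIV (\<lambda>_. lam) J (\<Pi>\<^sub>E j\<in>J. E j)"
    have X: "?X J' = {\<omega>. \<forall>j\<in>J'. \<omega> j \<in> E j}" for J'
      by (auto simp: prod_emb_def space_lam PiE_iff)
    have XP: "?X J' \<in> sets P" if "J' \<subseteq> J" for J'
      unfolding P_def by (rule sets_PiM_I) (use that J in \<open>auto intro: finite_subset\<close>)
    have X_prob: "emeasure P (?X J') = (\<Prod>j\<in>J'. emeasure lam (E j))" if "J' \<subseteq> J" for J'
      unfolding P_def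
      by (rule PP.emeasure_PiM_emb) (use that J in \<open>auto intro: finite_subset\<close>)
    have eq: "?f -` ?X J \<inter> space (P \<Otimes>\<^sub>M P) = ?X {j\<in>J. j < m} \<times> ?X {j\<in>J. \<not> j < m}"
      unfolding X by (auto simp: glue_def space_pair_measure)
    have "emeasure ?D (?X J) = emeasure (P \<Otimes>\<^sub>M P) (?X {j\<in>J. j < m} \<times> ?X {j\<in>J. \<not> j < m})"
      by (subst emeasure_distr) (use XP[of J] eq in auto)
    also have "\<dots> = emeasure P (?X {j\<in>J. j < m}) * emeasure P (?X {j\<in>J. \<not> j < m})"
      by (rule P.emeasure_pair_measure_Times) (auto intro: XP)
    also have "\<dots> = (\<Prod>j\<in>{j\<in>J. j < m}. emeasure lam (E j)) * (\<Prod>j\<in>{j\<in>J. \<not> j < m}. emeasure lam (E j))"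
      by (subst (1 2) X_prob) auto
    also have "\<dots> = (\<Prod>j\<in>J. emeasure lam (E j))"
      using J(1) by (subst prod.union_disjoint[symmetric]) (auto intro!: prod.cong)
    finally show "emeasure ?D (?X J) = (\<Prod>j\<in>J. emeasure lam (E j))" .
  qed (simp add: P_def)
  then show ?thesis by (simp add: P_def)
qed

lemma AE_shift:
  assumes "AE \<omega> in P. Q \<omega>" shows "AE \<omega> in P. Q (shift m \<omega>)"
  by (rule AE_distrD[OF shift_measurable]) (simp only: distr_shift assms)

lemma AE_shift_nat:
  assumes "AE \<omega> in P. Q \<omega>" shows "AE \<omega> in P. \<forall>n::nat. Q (shift (int n) \<omega>)"
  using AE_shift[OF assms] by (simp add: AE_all_countable)

lemma AE_glue:
  assumes "AE \<omega> in P. Q \<omega>" shows "AE \<omega> in P. AE \<omega>' in P. Q (glue m \<omega> \<omega>')"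
proof -
  have "AE x in P \<Otimes>\<^sub>M P. Q ((\<lambda>(\<omega>, \<omega>'). glue m \<omega> \<omega>') x)"
    by (rule AE_distrD[OF glue_measurable]) (simp only: distr_glue assms)
  from PPP.AE_pair[OF this] show ?thesis by simp
qed

lemma AE_glue_swap:
  assumes "AE \<omega> in P. Q \<omega>" shows "AE \<omega>' in P. AE \<omega> in P. Q (glue m \<omega> \<omega>')"
proof -
  have "AE x in P \<Otimes>\<^sub>M P. Q ((\<lambda>(\<omega>, \<omega>'). glue m \<omega> \<omega>') x)"
    by (rule AE_distrD[OF glue_measurable]) (simp only: distr_glue assms)
  then have "AE x in distr (P \<Otimes>\<^sub>M P) (P \<Otimes>\<^sub>M P) (\<lambda>(x, y). (y, x)). Q ((\<lambda>(\<omega>, \<omega>'). glue m \<omega> \<omega>') x)"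
    by (simp only: PPP.distr_pair_swap[symmetric])
  from PPP.AE_pair[OF AE_distrD[OF measurable_pair_swap' this]]
  show ?thesis by simp
qed

lemma nn_integral_shift:
  assumes "F \<in> borel_measurable P"
  shows "(\<integral>\<^sup>+\<omega>. F (shift m \<omega>) \<partial>P) = (\<integral>\<^sup>+\<omega>. F \<omega> \<partial>P)"
  using nn_integral_distr[OF shift_measurable, of F m] assms by (simp add: distr_shift)

lemma emeasure_shift:
  assumes "{\<omega>. Q \<omega>} \<in> sets P"
  shows "emeasure P {\<omega>. Q (shift m \<omega>)} = emeasure P {\<omega>. Q \<omega>}"
proof -
  have "emeasure (distr P P (shift m)) {\<omega>. Q \<omega>} = emeasure P (shift m -` {\<omega>. Q \<omega>} \<inter> space P)"
    by (rule emeasure_distr) (use assms in auto)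
  then show ?thesis by (simp add: distr_shift vimage_def)
qed

lemma nn_integral_glue:
  assumes [measurable]: "F \<in> borel_measurable P"
  shows "(\<integral>\<^sup>+\<omega>. F \<omega> \<partial>P) = (\<integral>\<^sup>+\<omega>. (\<integral>\<^sup>+\<omega>'. F (glue m \<omega> \<omega>') \<partial>P) \<partial>P)"
proof -
  have "(\<integral>\<^sup>+\<omega>. F \<omega> \<partial>P) = (\<integral>\<^sup>+x. F ((\<lambda>(\<omega>, \<omega>'). glue m \<omega> \<omega>') x) \<partial>(P \<Otimes>\<^sub>M P))"
    by (subst distr_glue[of m, symmetric]) (rule nn_integral_distr, measurable)
  also have "\<dots> = (\<integral>\<^sup>+\<omega>. (\<integral>\<^sup>+\<omega>'. F (glue m \<omega> \<omega>') \<partial>P) \<partial>P)"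
    by (subst P.nn_integral_fst[symmetric]) auto
  finally show ?thesis .
qed

lemma emeasure_glue:
  assumes "{\<omega>. Q \<omega>} \<in> sets P"
  shows "emeasure P {\<omega>. Q \<omega>} = (\<integral>\<^sup>+\<omega>. emeasure P {\<omega>'. Q (glue m \<omega> \<omega>')} \<partial>P)"
proof -
  have "{\<omega>'. Q (glue m \<omega> \<omega>')} \<in> sets P" for \<omega>
    using measurable_sets[OF glue_measurable_Pair[OF measurable_const[of \<omega> P P] measurable_ident] assms, of m]
    by (simp add: vimage_def)
  moreover have "(\<lambda>\<omega>'. indicator {\<omega>. Q \<omega>} (glue m \<omega> \<omega>') :: ennreal) = indicator {\<omega>'. Q (glue m \<omega> \<omega>')}" for \<omega>
    by (auto simp: indicator_def)
  ultimately have 1: "(\<integral>\<^sup>+\<omega>'. indicator {\<omega>. Q \<omega>} (glue m \<omega> \<omega>') \<partial>P) = emeasure P {\<omega>'. Q (glue m \<omega> \<omega>')}" for \<omega>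
    by simp
  have "emeasure P {\<omega>. Q \<omega>} = (\<integral>\<^sup>+\<omega>. indicator {\<omega>. Q \<omega>} \<omega> \<partial>P)"
    using assms by simp
  also have "\<dots> = (\<integral>\<^sup>+\<omega>. (\<integral>\<^sup>+\<omega>'. indicator {\<omega>. Q \<omega>} (glue m \<omega> \<omega>') \<partial>P) \<partial>P)"
    by (rule nn_integral_glue) (use assms in measurable)
  finally show ?thesis by (simp add: 1)
qed

section \<open>Ergodicity of the Bernoulli shift\<close>

definition finitely_determined :: "nat \<Rightarrow> (int \<Rightarrow> 'a) set \<Rightarrow> bool" where
  "finitely_determined N C \<longleftrightarrow> (\<forall>\<omega> \<omega>'. (\<forall>i. \<bar>i\<bar> < int N \<longrightarrow> \<omega> i = \<omega>' i) \<longrightarrow> (\<omega> \<in> C \<longleftrightarrow> \<omega>' \<in> C))"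

lemma finitely_determined_mono: "finitely_determined N C \<Longrightarrow> N \<le> N' \<Longrightarrow> finitely_determined N' C"
  unfolding finitely_determined_def by (metis of_nat_le_iff order.strict_trans2)

text \<open>The shift by 2N moves the window of indices of modulus below N to indices above N, so
  gluing at N puts the two events into independent samples.\<close>

lemma prob_finitely_determined_shift:
  assumes C: "C \<in> sets P" "finitely_determined N C"
  shows "P.prob (C \<inter> {\<omega>. shift (2 * int N) \<omega> \<in> C}) = P.prob C * P.prob C"
proof -
  have sC: "{\<omega>. shift (2 * int N) \<omega> \<in> C} \<in> sets P"
    using measurable_sets[OF shift_measurable C(1), of "2 * int N"] by (simp add: vimage_def)
  have "emeasure P (C \<inter> {\<omega>. shift (2 * int N) \<omega> \<in> C}) = emeasure P {\<omega>. \<omega> \<in> C \<and> shift (2 * int N) \<omega> \<in> C}"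
    by (simp add: Int_def)
  also have "\<dots> = (\<integral>\<^sup>+\<omega>. emeasure P {\<omega>'. glue (int N) \<omega> \<omega>' \<in> C \<and> shift (2 * int N) (glue (int N) \<omega> \<omega>') \<in> C} \<partial>P)"
    by (rule emeasure_glue) (use sets.Int[OF C(1) sC] in \<open>simp add: Int_def\<close>)
  also have "\<dots> = (\<integral>\<^sup>+\<omega>. indicator C \<omega> * emeasure P {\<omega>'. shift (2 * int N) \<omega>' \<in> C} \<partial>P)"
  proof (rule nn_integral_cong)
    fix \<omega>
    have "glue (int N) \<omega> \<omega>' \<in> C \<longleftrightarrow> \<omega> \<in> C" for \<omega>'
      using C(2) unfolding finitely_determined_def by (auto simp: glue_def abs_less_iff)
    moreover have "shift (2 * int N) (glue (int N) \<omega> \<omega>') \<in> C \<longleftrightarrow> shift (2 * int N) \<omega>' \<in> C" for \<omega>'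
    proof -
      have "\<forall>i. \<bar>i\<bar> < int N \<longrightarrow> shift (2 * int N) (glue (int N) \<omega> \<omega>') i = shift (2 * int N) \<omega>' i"
        by (auto simp: shift_def glue_def)
      then show ?thesis using C(2) unfolding finitely_determined_def by blast
    qed
    ultimately show "emeasure P {\<omega>'. glue (int N) \<omega> \<omega>' \<in> C \<and> shift (2 * int N) (glue (int N) \<omega> \<omega>') \<in> C}
        = indicator C \<omega> * emeasure P {\<omega>'. shift (2 * int N) \<omega>' \<in> C}"
      by (cases "\<omega> \<in> C") auto
  qed
  also have "\<dots> = emeasure P C * emeasure P C"
    using C(1) emeasure_shift[of "\<lambda>\<omega>. \<omega> \<in> C"] by (simp add: nn_integral_multc)
  finally show ?thesis
    by (simp add: P.emeasure_eq_measure flip: ennreal_mult)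
qed

text \<open>Induction over the generation of the sigma-algebra by single coordinates. A countable
  union is first cut to a finite one, at cost e/2, and then its n + 1 members are approximated
  within e/(2(n+1)) each.\<close>

lemma finitely_determined_approximation:
  assumes A: "A \<in> sets P" and e: "e > 0"
  shows "\<exists>N C. C \<in> sets P \<and> finitely_determined N C \<and> P.prob ((A - C) \<union> (C - A)) < e"
proof -
  let ?G = "{{\<omega>. \<omega> i \<in> B} |i B. B \<in> sets lam}"
  have "sets P = sigma_sets UNIV ?G"
    unfolding P_def sets_PiM_single by (simp add: space_lam PiE_UNIV_domain)
  then have "A \<in> sigma_sets UNIV ?G" using A by simp
  then show ?thesis using e
  proof (induction arbitrary: e rule: sigma_sets.induct)
    case (Basic A)
    then obtain i B where A: "A = {\<omega>. \<omega> i \<in> B}" "B \<in> sets lam" by blast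
    have "A \<in> sets P" using A measurable_sets[OF coordinate_measurable, of B i] by (simp add: vimage_def)
    moreover have "finitely_determined (nat (\<bar>i\<bar> + 1)) A"
      unfolding finitely_determined_def A by auto
    ultimately show ?case using Basic by (intro exI[of _ "nat (\<bar>i\<bar> + 1)"] exI[of _ A]) auto
  next
    case Empty
    then show ?case by (intro exI[of _ 0] exI[of _ "{}"]) (auto simp: finitely_determined_def)
  next
    case (Compl A)
    then obtain N C where C: "C \<in> sets P" "finitely_determined N C" "P.prob ((A - C) \<union> (C - A)) < e" by blast
    have "((UNIV - A) - (UNIV - C)) \<union> ((UNIV - C) - (UNIV - A)) = (A - C) \<union> (C - A)" by auto
    moreover have "UNIV - C \<in> sets P" using sets.compl_sets[OF C(1)] by simp
    moreover have "finitely_determined N (UNIV - C)" using C(2) unfolding finitely_determined_def by blast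
    ultimately show ?case using C(3) by (intro exI[of _ N] exI[of _ "UNIV - C"]) auto
  next
    case (Union A)
    have AP: "A i \<in> sets P" for i using Union(1) \<open>sets P = sigma_sets UNIV ?G\<close> by simp
    have "(\<lambda>n. P.prob (\<Union>i\<le>n. A i)) \<longlonglongrightarrow> P.prob (\<Union>i. \<Union>j\<le>i. A j)"
      by (rule P.finite_Lim_measure_incseq) (use AP in \<open>auto simp: incseq_def intro: order_trans\<close>)
    moreover have "(\<Union>i. \<Union>j\<le>i. A j) = (\<Union>i. A i)" by auto
    ultimately have lim: "(\<lambda>n. P.prob (\<Union>i\<le>n. A i)) \<longlonglongrightarrow> P.prob (\<Union>i. A i)" by simp
    obtain n where "norm (P.prob (\<Union>i\<le>n. A i) - P.prob (\<Union>i. A i)) < e / 2"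
      using LIMSEQ_D[OF lim, of "e/2"] Union.prems by auto
    then have n: "P.prob (\<Union>i. A i) - P.prob (\<Union>i\<le>n. A i) < e / 2"
      unfolding real_norm_def by linarith
    define d where "d = e / (2 * real (Suc n))"
    have d: "d > 0" using Union.prems by (simp add: d_def)
    have "\<forall>i. \<exists>N C. C \<in> sets P \<and> finitely_determined N C \<and> P.prob ((A i - C) \<union> (C - A i)) < d"
      using Union.IH d by blast
    then obtain N C where NC: "\<And>i. C i \<in> sets P" "\<And>i. finitely_determined (N i) (C i)"
      "\<And>i. P.prob ((A i - C i) \<union> (C i - A i)) < d" by metis
    define C' where "C' = (\<Union>i\<le>n. C i)"
    define N' where "N' = Max (N ` {..n})"
    have C'P: "C' \<in> sets P" unfolding C'_def using NC by auto
    have "finitely_determined N' (C i)" if "i \<le> n" for i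
      by (rule finitely_determined_mono[OF NC(2)]) (use that in \<open>auto simp: N'_def\<close>)
    then have "finitely_determined N' C'"
      unfolding finitely_determined_def C'_def UN_iff by (intro allI impI bex_cong) auto
    moreover have "P.prob (((\<Union>i. A i) - C') \<union> (C' - (\<Union>i. A i))) < e"
    proof -
      let ?R = "(\<Union>i. A i) - (\<Union>i\<le>n. A i)"
      have "P.prob (((\<Union>i. A i) - C') \<union> (C' - (\<Union>i. A i))) \<le> P.prob (?R \<union> (\<Union>i\<le>n. (A i - C i) \<union> (C i - A i)))"
        by (rule P.finite_measure_mono) (use AP NC C'P in \<open>auto simp: C'_def\<close>)
      also have "\<dots> \<le> P.prob ?R + P.prob (\<Union>i\<le>n. (A i - C i) \<union> (C i - A i))"
        by (rule measure_Un_le) (use AP NC in auto)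
      also have "P.prob ?R = P.prob (\<Union>i. A i) - P.prob (\<Union>i\<le>n. A i)"
        by (rule P.finite_measure_Diff) (use AP in auto)
      also have "P.prob (\<Union>i\<le>n. (A i - C i) \<union> (C i - A i)) \<le> (\<Sum>i\<le>n. P.prob ((A i - C i) \<union> (C i - A i)))"
        by (rule P.finite_measure_subadditive_finite) (use AP NC in auto)
      also have "\<dots> \<le> (\<Sum>i\<le>n. d)"
        by (intro sum_mono) (use NC in \<open>auto intro: less_imp_le\<close>)
      also have "\<dots> = e / 2" by (simp add: d_def field_simps)
      finally show ?thesis using n by simp
    qed
    ultimately show ?case using C'P by blast
  qed
qed

text \<open>Mixing argument: an invariant \<open>A\<close> is close to an event \<open>C\<close> of
  a finite window, hence also to the intersection of \<open>C\<close> with its far shift, whose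
  probability is the square of that of \<open>C\<close>. So the probability of \<open>A\<close>
  equals its own square.\<close>

lemma shift_invariant_trivial:
  assumes A: "A \<in> sets P" and inv: "shift 1 -` A \<inter> space P = A"
  shows "P.prob A = 0 \<or> P.prob A = 1"
proof -
  have inv1: "shift 1 \<omega> \<in> A \<longleftrightarrow> \<omega> \<in> A" for \<omega> using inv by auto
  have inv: "shift (int n) \<omega> \<in> A \<longleftrightarrow> \<omega> \<in> A" for n \<omega>
  proof (induction n)
    case (Suc n)
    then show ?case using inv1[of "shift (int n) \<omega>"] by simp
  qed simp
  have "\<bar>P.prob A - P.prob A * P.prob A\<bar> \<le> e" if e: "e > 0" for e
  proof -
    \<comment> \<open>Passing from \<open>A\<close> to the intersection costs at most e/2, one e/4
      for \<open>C\<close> and one for its shift; replacing the square for \<open>C\<close> by the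
      square for \<open>A\<close> costs at most 2 times e/4.\<close>
    obtain N C where C: "C \<in> sets P" "finitely_determined N C" "P.prob ((A - C) \<union> (C - A)) < e / 4"
      using finitely_determined_approximation[OF A, of "e/4"] e by auto
    let ?D = "(A - C) \<union> (C - A)" and ?s = "shift (2 * int N)"
    have D: "?D \<in> sets P" using A C by auto
    have sD: "{\<omega>. ?s \<omega> \<in> ?D} \<in> sets P" and sC: "{\<omega>. ?s \<omega> \<in> C} \<in> sets P"
      using measurable_sets[OF shift_measurable D, of "2 * int N"] measurable_sets[OF shift_measurable C(1), of "2 * int N"]
      by (auto simp: vimage_def)
    have sD_prob: "P.prob {\<omega>. ?s \<omega> \<in> ?D} = P.prob ?D"
      using emeasure_shift[of "\<lambda>\<omega>. \<omega> \<in> ?D" "2 * int N"] D unfolding measure_def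
      by (simp only: Collect_mem_eq)
    have near: "\<bar>P.prob X - P.prob Y\<bar> \<le> P.prob Z"
      if "X \<in> sets P" "Y \<in> sets P" "Z \<in> sets P" "X \<subseteq> Y \<union> Z" "Y \<subseteq> X \<union> Z" for X Y Z
    proof -
      have "P.prob X \<le> P.prob (Y \<union> Z)" "P.prob Y \<le> P.prob (X \<union> Z)"
        using that by (auto intro!: P.finite_measure_mono)
      then show ?thesis using measure_Un_le[of Y P Z] measure_Un_le[of X P Z] that by auto
    qed
    have a: "\<bar>P.prob A - P.prob C\<bar> \<le> e / 4"
    proof -
      have "A \<subseteq> C \<union> ?D" "C \<subseteq> A \<union> ?D" by auto
      from near[OF A C(1) D this] show ?thesis using C(3) by linarith
    qed
    have "\<bar>P.prob A - P.prob (C \<inter> {\<omega>. ?s \<omega> \<in> C})\<bar> \<le> P.prob (?D \<union> {\<omega>. ?s \<omega> \<in> ?D})"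
    proof (rule near)
      show "A \<subseteq> C \<inter> {\<omega>. ?s \<omega> \<in> C} \<union> (?D \<union> {\<omega>. ?s \<omega> \<in> ?D})"
        using inv[of "2 * N"] by auto
      show "C \<inter> {\<omega>. ?s \<omega> \<in> C} \<subseteq> A \<union> (?D \<union> {\<omega>. ?s \<omega> \<in> ?D})" by auto
    qed (use A C D sD sC in auto)
    also have "\<dots> \<le> e / 2"
      using measure_Un_le[OF D sD] sD_prob C(3) by simp
    finally have b: "\<bar>P.prob A - P.prob C * P.prob C\<bar> \<le> e / 2"
      by (simp add: prob_finitely_determined_shift[OF C(1,2)])
    have "P.prob C * P.prob C - P.prob A * P.prob A = (P.prob C - P.prob A) * (P.prob C + P.prob A)"
      by (simp add: algebra_simps)
    then have "\<bar>P.prob C * P.prob C - P.prob A * P.prob A\<bar> = \<bar>P.prob C - P.prob A\<bar> * \<bar>P.prob C + P.prob A\<bar>"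
      by (simp add: abs_mult)
    also have "\<dots> \<le> e / 4 * 2"
    proof (rule mult_mono)
      show "\<bar>P.prob C - P.prob A\<bar> \<le> e / 4" using a by linarith
      show "\<bar>P.prob C + P.prob A\<bar> \<le> 2"
        using P.prob_le_1[of A] P.prob_le_1[of C] measure_nonneg[of P A] measure_nonneg[of P C] by linarith
    qed (use e in auto)
    finally show ?thesis using b by linarith
  qed
  then have "\<bar>P.prob A - P.prob A * P.prob A\<bar> \<le> 0"
    by (rule field_le_epsilon) simp
  then have "P.prob A * (1 - P.prob A) = 0" by (simp add: algebra_simps)
  then show ?thesis by simp
qed

sublocale erg: ergodic_map P "shift 1"
  by unfold_locales (use distr_shift shift_invariant_trivial in auto)

end

section \<open>Matrices\<close>

definition outer :: "real^'m \<Rightarrow> real^'n \<Rightarrow> real^'n^'m" where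
  "outer a y = (\<chi> i j. a $ i * y $ j)"

lemma outer_mult_vec: "outer a y *v w = (y \<bullet> w) *\<^sub>R a"
  by (simp add: outer_def matrix_vector_mult_def vec_eq_iff inner_vec_def sum_distrib_left sum_distrib_right ac_simps)

lemma mult_outer: "M ** outer a y = outer (M *v a) y"
  by (simp add: outer_def matrix_matrix_mult_def matrix_vector_mult_def vec_eq_iff sum_distrib_left sum_distrib_right ac_simps)

lemma transpose_outer: "transpose (outer a y) = outer y a"
  by (simp add: outer_def transpose_def vec_eq_iff mult.commute)

lemma norm_outer: "norm (outer a y) = norm a * norm y"
proof -
  have "outer a y $ i = (a $ i) *\<^sub>R y" for i
    by (simp add: outer_def vec_eq_iff)
  then show ?thesis
    by (simp add: norm_vec_def[of "outer a y"] L2_set_left_distrib[symmetric] norm_vec_def[of a])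
qed

lemma matrix_mult_scaleR_right: "A ** (c *\<^sub>R B) = c *\<^sub>R (A ** B)" for A :: "real^'n^'m"
  by (simp add: matrix_matrix_mult_def vec_eq_iff sum_distrib_left ac_simps)

lemma transpose_scaleR: "transpose (c *\<^sub>R A) = c *\<^sub>R transpose A" for A :: "real^'n^'m"
  by (simp add: transpose_def vec_eq_iff)

lemma scaleR_mult_vec: "(c *\<^sub>R A) *v v = c *\<^sub>R (A *v v)" for A :: "real^'n^'m"
  by (simp add: matrix_vector_mult_def vec_eq_iff sum_distrib_left ac_simps)

lemma continuous_on_matrix_mult [continuous_intros]:
  fixes f :: "'a::topological_space \<Rightarrow> real^'n^'m" and g :: "'a \<Rightarrow> real^'k^'n"
  assumes "continuous_on S f" "continuous_on S g" shows "continuous_on S (\<lambda>x. f x ** g x)"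
  unfolding matrix_matrix_mult_def by (intro continuous_intros assms)

lemma continuous_on_matrix_vector_mult [continuous_intros]:
  fixes f :: "'a::topological_space \<Rightarrow> real^'n^'m"
  assumes "continuous_on S f" "continuous_on S g" shows "continuous_on S (\<lambda>x. f x *v g x)"
  unfolding matrix_vector_mult_def by (intro continuous_intros assms)

lemma continuous_on_transpose [continuous_intros]:
  fixes f :: "'a::topological_space \<Rightarrow> real^'n^'m"
  assumes "continuous_on S f" shows "continuous_on S (\<lambda>x. transpose (f x))"
  unfolding transpose_def by (intro continuous_intros assms)

lemma borel_measurable_matrix_mult [measurable (raw)]:
  fixes f :: "'a \<Rightarrow> real^'n^'m" and g :: "'a \<Rightarrow> real^'k^'n"
  assumes "f \<in> borel_measurable M" "g \<in> borel_measurable M" shows "(\<lambda>x. f x ** g x) \<in> borel_measurable M"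
  using assms by (rule borel_measurable_continuous_Pair) (intro continuous_intros)

lemma borel_measurable_matrix_vector_mult [measurable (raw)]:
  fixes f :: "'a \<Rightarrow> real^'n^'m"
  assumes "f \<in> borel_measurable M" "g \<in> borel_measurable M" shows "(\<lambda>x. f x *v g x) \<in> borel_measurable M"
  using assms by (rule borel_measurable_continuous_Pair) (intro continuous_intros)

text \<open>Every limit point of the normalized matrices has the form
  \<open>outer (z /\<^sub>R norm z) y\<close> with an unknown unit vector \<open>y\<close>. A
  continuous \<open>f\<close> that is blind to \<open>y\<close> has the same value at all of them,
  and compactness of the unit ball turns this into convergence of the whole sequence.\<close>

lemma rank_one_limits_continuous:
  fixes X :: "nat \<Rightarrow> real^'d::finite^'d"
  assumes X: "rank_one_limits_with_range (\<lambda>n. (1 / norm (X n)) *\<^sub>R X n) z"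
    and f: "continuous_on UNIV f"
    and c: "\<And>y. norm y = 1 \<Longrightarrow> f (outer (z /\<^sub>R norm z) y) = c"
    and z: "z \<noteq> 0"
  shows "(\<lambda>n. f ((1 / norm (X n)) *\<^sub>R X n)) \<longlonglongrightarrow> (c :: real)"
proof (rule ccontr)
  define Y where "Y n = (1 / norm (X n)) *\<^sub>R X n" for n
  \<comment> \<open>Division by zero yields 0, so \<open>Y n\<close> vanishes when
    \<open>X n\<close> does; the rank of the limit later excludes this eventually along the
    subsequence.\<close>
  have Y01: "norm (Y n) = 0 \<or> norm (Y n) = 1" for n by (auto simp: Y_def)
  assume "\<not> (\<lambda>n. f ((1 / norm (X n)) *\<^sub>R X n)) \<longlonglongrightarrow> c"
  then obtain e where e: "e > 0" "\<And>N. \<exists>n\<ge>N. \<not> norm (f (Y n) - c) < e"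
    unfolding Y_def LIMSEQ_iff by blast
  obtain r :: "nat \<Rightarrow> nat" where r: "strict_mono r" "\<And>n. \<not> norm (f (Y (r n)) - c) < e"
  proof -
    have "infinite {n. \<not> norm (f (Y n) - c) < e}"
      unfolding infinite_nat_iff_unbounded_le using e(2) by blast
    from infinite_enumerate[OF this] show ?thesis using that by auto
  qed
  have "\<forall>n. (Y \<circ> r) n \<in> cball 0 1"
  proof
    fix n show "(Y \<circ> r) n \<in> cball 0 1" using Y01[of "r n"] by auto
  qed
  moreover have "compact (cball (0::real^'d^'d) 1)" by simp
  ultimately obtain L s where s: "strict_mono s" "((Y \<circ> r) \<circ> s) \<longlonglongrightarrow> L"
    unfolding compact_def by blast
  have "strict_mono (r \<circ> s)" using r(1) s(1) by (simp add: strict_mono_o)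
  moreover have lim: "(Y \<circ> (r \<circ> s)) \<longlonglongrightarrow> L" using s(2) by (simp add: comp_assoc)
  ultimately have "limit_point Y L" unfolding limit_point_def by blast
  then have L: "rank L = 1" "range (\<lambda>v. L *v v) = span {z}"
    using X unfolding rank_one_limits_with_range_def Y_def by auto
  have "L \<noteq> 0" using L(1) by (metis rank_0 zero_neq_one)
  have nl: "(\<lambda>n. norm ((Y \<circ> (r \<circ> s)) n)) \<longlonglongrightarrow> norm L" by (intro tendsto_norm lim)
  have "norm L = 1"
  proof -
    have "\<forall>\<^sub>F n in sequentially. norm ((Y \<circ> (r \<circ> s)) n) > 0"
      using order_tendstoD(1)[OF nl, of 0] \<open>L \<noteq> 0\<close> by simp
    then have "\<forall>\<^sub>F n in sequentially. norm ((Y \<circ> (r \<circ> s)) n) = 1"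
    proof eventually_elim
      case (elim n) then show ?case using Y01[of "(r \<circ> s) n"] by auto
    qed
    then have "(\<lambda>n. norm ((Y \<circ> (r \<circ> s)) n)) \<longlonglongrightarrow> 1" by (rule tendsto_eventually)
    with nl show ?thesis using LIMSEQ_unique by blast
  qed
  define a where "a = z /\<^sub>R norm z"
  have "\<exists>y. L *v axis j 1 = y *\<^sub>R a" for j
  proof -
    have "L *v axis j 1 \<in> span {z}" using L(2) by blast
    then obtain k where "L *v axis j 1 = k *\<^sub>R z" by (auto simp: span_singleton)
    then show ?thesis using z by (intro exI[of _ "k * norm z"]) (simp add: a_def)
  qed
  then obtain y where y: "\<And>j. L *v axis j 1 = y j *\<^sub>R a" by metis
  have "L $ i $ j = (L *v axis j 1) $ i" for i j
    by (simp add: matrix_vector_mult_basis column_def)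
  then have Lo: "L = outer a (\<chi> j. y j)"
    by (simp add: y outer_def vec_eq_iff)
  have "norm a = 1" using z by (simp add: a_def)
  then have "norm (\<chi> j. y j) = 1" using \<open>norm L = 1\<close> by (simp add: Lo norm_outer)
  then have "f L = c" using c Lo by (simp add: a_def)
  moreover have "(\<lambda>n. f ((Y \<circ> (r \<circ> s)) n)) \<longlonglongrightarrow> f L"
    by (rule continuous_on_tendsto_compose[OF f lim]) auto
  ultimately have "(\<lambda>n. f ((Y \<circ> (r \<circ> s)) n)) \<longlonglongrightarrow> c" by simp
  from LIMSEQ_D[OF this e(1)] obtain N where "norm (f (Y (r (s N))) - c) < e" by auto
  with r(2) show False by blast
qed

lemma rank_one_limits_left_mult:
  fixes X :: "nat \<Rightarrow> real^'d::finite^'d" and M :: "real^'d^'d"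
  assumes X: "rank_one_limits_with_range (\<lambda>n. (1 / norm (X n)) *\<^sub>R X n) z" and z: "z \<noteq> 0"
  shows "(\<lambda>n. norm (M ** X n) / norm (X n)) \<longlonglongrightarrow> norm (M *v (z /\<^sub>R norm z))"
proof -
  have "(\<lambda>n. norm (M ** ((1 / norm (X n)) *\<^sub>R X n))) \<longlonglongrightarrow> norm (M *v (z /\<^sub>R norm z))"
    by (rule rank_one_limits_continuous[OF X _ _ z])
       (auto intro!: continuous_intros simp: mult_outer norm_outer)
  then show ?thesis by (simp add: matrix_mult_scaleR_right)
qed

lemma rank_one_limits_transpose_vec:
  fixes X :: "nat \<Rightarrow> real^'d::finite^'d"
  assumes X: "rank_one_limits_with_range (\<lambda>n. (1 / norm (X n)) *\<^sub>R X n) z" and z: "z \<noteq> 0"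
  shows "(\<lambda>n. norm (transpose (X n) *v w) / norm (X n)) \<longlonglongrightarrow> \<bar>(z /\<^sub>R norm z) \<bullet> w\<bar>"
proof -
  have "(\<lambda>n. norm (transpose ((1 / norm (X n)) *\<^sub>R X n) *v w)) \<longlonglongrightarrow> \<bar>(z /\<^sub>R norm z) \<bullet> w\<bar>"
    by (rule rank_one_limits_continuous[OF X _ _ z])
       (auto intro!: continuous_intros simp: transpose_outer outer_mult_vec simp del: transpose_matrix_vector)
  then show ?thesis by (simp add: transpose_scaleR scaleR_mult_vec del: transpose_matrix_vector)
qed

lemma unit_eq_up_to_sign:
  fixes a e :: "'a::real_inner"
  assumes "norm a = 1" "norm e = 1" "\<And>w. \<bar>w \<bullet> a\<bar> = \<bar>w \<bullet> e\<bar>"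
  shows "a = e \<or> a = - e"
proof -
  have "\<bar>a \<bullet> e\<bar> = 1" using assms(3)[of a] assms(1) by (simp add: norm_eq_1)
  then have "a \<bullet> e = 1 \<or> a \<bullet> e = -1" by auto
  then have "(a - e) \<bullet> (a - e) = 0 \<or> (a + e) \<bullet> (a + e) = 0"
    using assms(1,2) by (auto simp: norm_eq_1 inner_diff inner_add inner_commute)
  then show ?thesis by (auto simp: eq_neg_iff_add_eq_0)
qed

lemma unit_eq_up_to_sign_matrix:
  fixes c e :: "real^'d::finite"
  assumes "norm c = 1" "norm e = 1" and M: "\<And>M :: real^'d^'d. norm (M *v c) = norm (M *v e)"
  shows "c = e \<or> c = - e"
proof (rule unit_eq_up_to_sign[OF assms(1,2)])
  \<comment> \<open>The test matrix \<open>outer c w\<close> sends v to (w \<bullet> v) c, so the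
    norm of the image is \<bar>w \<bullet> v\<bar>.\<close>
  fix w show "\<bar>w \<bullet> c\<bar> = \<bar>w \<bullet> e\<bar>" using M[of "outer c w"] assms(1) by (simp add: outer_mult_vec)
qed

lemma orthogonal_to_span_iff:
  fixes c :: "'a::euclidean_space"
  shows "(\<forall>v\<in>span B. c \<bullet> v = 0) \<longleftrightarrow> (\<forall>v\<in>B. c \<bullet> v = 0)"
proof
  assume "\<forall>v\<in>B. c \<bullet> v = 0"
  moreover have "subspace {v. c \<bullet> v = 0}" by (rule subspace_hyperplane)
  ultimately have "span B \<subseteq> {v. c \<bullet> v = 0}" by (intro span_minimal) auto
  then show "\<forall>v\<in>span B. c \<bullet> v = 0" by auto
qed (auto intro: span_base)

lemma norm_transpose: "norm (transpose A) = norm A" for A :: "real^'n^'m"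
proof -
  have "(norm (transpose A))\<^sup>2 = (norm A)\<^sup>2"
    unfolding power2_norm_eq_inner inner_vec_def transpose_def by (simp, rule sum.swap)
  then show ?thesis by simp
qed

section \<open>Cocycle identities for the products\<close>

lemma Sstar_eq_transpose: "Sstar \<omega> n = transpose (Sprod \<omega> n)"
  by (induction n) (auto simp: matrix_transpose_mul transpose_mat)

lemma Acoef_shift: "Acoef (shift m \<omega>) n = Acoef \<omega> (n + m)"
  by (simp add: Acoef_def shift_def algebra_simps)

lemma Bcoef_shift: "Bcoef (shift m \<omega>) n = Bcoef \<omega> (n + m)"
  by (simp add: Bcoef_def shift_def algebra_simps)

lemma Sprod_add: "Sprod \<omega> (n + m) = Sprod (shift (int m) \<omega>) n ** Sprod \<omega> m"
  by (induction n) (auto simp: Acoef_shift matrix_mul_assoc algebra_simps)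

lemma Sprod_cong:
  assumes "\<And>i. 0 \<le> i \<Longrightarrow> i < int n \<Longrightarrow> \<omega> i = \<omega>' i" shows "Sprod \<omega> n = Sprod \<omega>' n"
  using assms by (induction n) (auto simp: Acoef_def)

lemma Tprod_cong:
  assumes "\<And>i. 0 \<le> i \<Longrightarrow> i < int n \<Longrightarrow> \<omega> i = \<omega>' i" shows "Tprod \<omega> n = Tprod \<omega>' n"
  using assms
proof (induction n)
  case (Suc n)
  then have "Tprod \<omega> n = Tprod \<omega>' n" "Sprod \<omega> n = Sprod \<omega>' n" "\<omega> (int n) = \<omega>' (int n)"
    by (auto intro!: Sprod_cong)
  then show ?case by (simp add: Acoef_def Bcoef_def)
qed simp

lemma invertible_Sprod:
  assumes "\<And>i. invertible (fst (\<omega> i))" shows "invertible (Sprod \<omega> n)"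
proof (induction n)
  case 0 show ?case by (auto simp: invertible_def intro!: exI[of _ "mat 1"])
next
  case (Suc n) then show ?case using assms by (auto simp: Acoef_def intro!: invertible_mult)
qed

lemma invertible_mult_vec_eq_0:
  fixes M :: "real^'d^'d" assumes "invertible M" shows "M *v v = 0 \<longleftrightarrow> v = 0"
  using assms by (metis invertible_left_inverse matrix_left_invertible_ker matrix_vector_mult_0_right)

lemma inj_mult_vec:
  fixes M :: "real^'d^'d" assumes "invertible M" shows "inj (\<lambda>v. M *v v)"
proof (rule injI)
  fix v w assume "M *v v = M *v w"
  then have "M *v (v - w) = 0" by (simp add: matrix_vector_mult_diff_distrib)
  then show "v = w" using invertible_mult_vec_eq_0[OF assms] by simp
qed

text \<open>A discrete variation-of-constants formula. The scalars \<open>c k\<close> are free: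
  subtracting c_k A from B in the factor with index k removes exactly c_k S_n from T_n. They will be
  the values of \<xi> along the orbit.\<close>

lemma Tprod_minus_Sprod_sum:
  "Tprod \<omega> n *v v - (\<Sum>k<n. c k) *\<^sub>R (Sprod \<omega> n *v v) =
    (\<Sum>k<n. Sprod (shift (int (Suc k)) \<omega>) (n - Suc k) *v
       ((Bcoef \<omega> (int (Suc k)) - c k *\<^sub>R Acoef \<omega> (int (Suc k))) *v (Sprod \<omega> k *v v)))"
proof (induction n)
  case (Suc n)
  let ?A = "Acoef \<omega> (int (Suc n))" and ?B = "Bcoef \<omega> (int (Suc n))"
  let ?t = "\<lambda>n k. Sprod (shift (int (Suc k)) \<omega>) (n - Suc k) *v
       ((Bcoef \<omega> (int (Suc k)) - c k *\<^sub>R Acoef \<omega> (int (Suc k))) *v (Sprod \<omega> k *v v))"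
  have step: "?t (Suc n) k = ?A *v ?t n k" if "k < n" for k
  proof -
    have "Suc n - Suc k = Suc (n - Suc k)" using that by simp
    moreover have "Acoef (shift (int (Suc k)) \<omega>) (int (Suc (n - Suc k))) = ?A"
      using that by (simp add: Acoef_shift of_nat_diff add.commute)
    ultimately show ?thesis by (simp add: matrix_vector_mul_assoc matrix_mul_assoc del: of_nat_Suc)
  qed
  have "Tprod \<omega> (Suc n) *v v - (\<Sum>k<Suc n. c k) *\<^sub>R (Sprod \<omega> (Suc n) *v v) =
    ?A *v (Tprod \<omega> n *v v - (\<Sum>k<n. c k) *\<^sub>R (Sprod \<omega> n *v v)) + (?B - c n *\<^sub>R ?A) *v (Sprod \<omega> n *v v)"
    by (simp add: matrix_vector_mult_add_rdistrib matrix_vector_mul_assoc[symmetric] scaleR_add_left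
        matrix_vector_mult_diff_distrib matrix_vector_mult_diff_rdistrib scaleR_mult_vec
        matrix_vector_mult_scaleR del: of_nat_Suc)
  also have "?A *v (Tprod \<omega> n *v v - (\<Sum>k<n. c k) *\<^sub>R (Sprod \<omega> n *v v)) = (\<Sum>k<n. ?t (Suc n) k)"
  proof -
    have "?A *v (\<Sum>k<n. ?t n k) = (\<Sum>k<n. ?A *v ?t n k)"
      by (rule linear_sum) simp
    also have "\<dots> = (\<Sum>k<n. ?t (Suc n) k)" by (intro sum.cong refl) (simp only: step lessThan_iff)
    finally show ?thesis by (simp only: Suc)
  qed
  finally show ?case by (simp del: of_nat_Suc)
qed simp

section \<open>Finite invariant families of subspaces\<close>

lemma closed_maps_into:
  fixes \<V> :: "(real^'d::finite) set set"
  assumes "finite \<V>" "\<And>V. V \<in> \<V> \<Longrightarrow> closed V"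
  shows "closed {M :: real^'d^'d. \<forall>V\<in>\<V>. \<exists>W\<in>\<V>. \<forall>v\<in>V. M *v v \<in> W}"
proof -
  have "{M :: real^'d^'d. \<forall>V\<in>\<V>. \<exists>W\<in>\<V>. \<forall>v\<in>V. M *v v \<in> W} = (\<Inter>V\<in>\<V>. \<Union>W\<in>\<V>. \<Inter>v\<in>V. (\<lambda>M. M *v v) -` W)"
    by auto
  also have "closed \<dots>"
    by (intro closed_INT closed_UN ballI assms closed_vimage continuous_intros)
  finally show ?thesis .
qed

text \<open>The matrices mapping each member of the family into some member form a closed set stable
  under products, so it contains the closed semigroup. An invertible matrix in it maps members onto
  members because dimensions agree, hence permutes the finite family; this gives the equality of
  unions in \<open>strongly_irreducible\<close>.\<close>

lemma not_strongly_irreducible: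
  fixes \<mu> :: "(real^'d::finite^'d) measure"
  assumes sets: "sets \<mu> = sets borel" and fin: "finite \<V>" "\<V> \<noteq> {}"
    and V: "\<And>V. V \<in> \<V> \<Longrightarrow> subspace V \<and> V \<noteq> {0} \<and> V \<noteq> UNIV \<and> dim V = k"
    and AE: "AE M in \<mu>. \<forall>V\<in>\<V>. \<exists>W\<in>\<V>. \<forall>v\<in>V. M *v v \<in> W"
  shows "\<not> strongly_irreducible \<mu>"
proof -
  define C :: "(real^'d^'d) set" where "C = {M. \<forall>V\<in>\<V>. \<exists>W\<in>\<V>. \<forall>v\<in>V. M *v v \<in> W}"
  have "closed C" unfolding C_def
    using fin(1) V closed_subspace by (intro closed_maps_into) auto
  have "support_GL \<mu> \<subseteq> C"
  proof
    fix M assume M: "M \<in> support_GL \<mu>"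
    show "M \<in> C"
    proof (rule ccontr)
      assume "M \<notin> C"
      then obtain e where e: "e > 0" "ball M e \<subseteq> - C"
        using \<open>closed C\<close> open_contains_ball[of "- C"] by (auto simp: open_Compl)
      have "AE N in \<mu>. N \<notin> ball M e"
        using AE by eventually_elim (use e in \<open>auto simp: C_def\<close>)
      then have "emeasure \<mu> (ball M e) = 0"
        by (subst (asm) AE_iff_measurable[of "ball M e"]) (auto simp: sets sets_eq_imp_space_eq[OF sets])
      then show False using M e by (auto simp: support_GL_def)
    qed
  qed
  then have "gen_semigroup (support_GL \<mu>) \<subseteq> C"
  proof (intro subsetI)
    fix M assume S: "support_GL \<mu> \<subseteq> C" and "M \<in> gen_semigroup (support_GL \<mu>)"
    from this(2) show "M \<in> C"
    proof induction
      case (base M) then show ?case using S by auto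
    next
      case (mult M N)
      then show ?case unfolding C_def
        by (simp add: matrix_vector_mul_assoc[symmetric]) meson
    qed
  qed
  then have clC: "closure (gen_semigroup (support_GL \<mu>)) \<subseteq> C"
    using \<open>closed C\<close> closure_minimal by blast
  have "(\<lambda>v. M *v v) ` (\<Union>\<V>) = \<Union>\<V>" if M: "M \<in> closed_semigroup_GL \<mu>" for M
  proof -
    have "M \<in> C" and inv: "invertible M" using M clC by (auto simp: closed_semigroup_GL_def)
    have lin: "linear (\<lambda>v. M *v v)" by simp
    have inj: "inj (\<lambda>v. M *v v)" by (rule inj_mult_vec[OF inv])
    have img: "(\<lambda>v. M *v v) ` V \<in> \<V>" if "V \<in> \<V>" for V
    proof -
      have "\<exists>W\<in>\<V>. \<forall>v\<in>V. M *v v \<in> W" using \<open>M \<in> C\<close> that by (simp add: C_def)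
      then obtain W where W: "W \<in> \<V>" "(\<lambda>v. M *v v) ` V \<subseteq> W" by (auto simp: image_subset_iff)
      have "dim ((\<lambda>v. M *v v) ` V) = dim V"
        by (rule dim_image_eq[OF lin]) (rule inj_on_subset[OF inj subset_UNIV])
      then have "(\<lambda>v. M *v v) ` V = W"
        using V[OF that] V[OF W(1)]
        by (intro subspace_dim_equal[OF linear_subspace_image[OF lin] _ W(2)]) auto
      with W show ?thesis by simp
    qed
    have "(\<lambda>V. (\<lambda>v. M *v v) ` V) ` \<V> = \<V>"
      by (rule endo_inj_surj[OF fin(1)]) (use img in \<open>auto simp: inj_on_def inj_image_eq_iff[OF inj]\<close>)
    moreover have "(\<lambda>v. M *v v) ` (\<Union>\<V>) = \<Union>((\<lambda>V. (\<lambda>v. M *v v) ` V) ` \<V>)" by (rule image_Union)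
    ultimately show ?thesis by simp
  qed
  moreover have "\<forall>V\<in>\<V>. subspace V \<and> V \<noteq> {0} \<and> V \<noteq> UNIV" using V by blast
  ultimately show ?thesis
    unfolding strongly_irreducible_def not_not
    by (intro exI[of _ \<V>] conjI ballI fin) (assumption | blast)+
qed

section \<open>Limit directions of the random products\<close>

locale matrix_cocycle = iid_sequence lam
  for lam :: "((real^'d::finite^'d) \<times> (real^'d^'d)) measure" +
  fixes z zt :: "(int \<Rightarrow> (real^'d^'d) \<times> (real^'d^'d)) \<Rightarrow> real^'d"
  assumes sets_lam: "sets lam = sets borel"
    and GL: "AE p in lam. invertible (fst p)"
    and irr: "strongly_irreducible (law_A lam)"
    and Z: "AE \<omega> in P. z \<omega> \<noteq> 0 \<and>
              rank_one_limits_with_range (\<lambda>n. (1 / norm (Sprod (shift (- int n) \<omega>) n)) *\<^sub>R Sprod (shift (- int n) \<omega>) n) (z \<omega>)"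
    and Zt: "AE \<omega> in P. zt \<omega> \<noteq> 0 \<and>
              rank_one_limits_with_range (\<lambda>n. (1 / norm (Sstar \<omega> n)) *\<^sub>R Sstar \<omega> n) (zt \<omega>)"
begin

definition a :: "(int \<Rightarrow> (real^'d^'d) \<times> (real^'d^'d)) \<Rightarrow> real^'d" where
  "a \<omega> = z \<omega> /\<^sub>R norm (z \<omega>)"

definition b :: "(int \<Rightarrow> (real^'d^'d) \<times> (real^'d^'d)) \<Rightarrow> real^'d" where
  "b \<omega> = zt \<omega> /\<^sub>R norm (zt \<omega>)"

definition past_prod :: "nat \<Rightarrow> (int \<Rightarrow> (real^'d^'d) \<times> (real^'d^'d)) \<Rightarrow> real^'d^'d" where
  "past_prod n \<omega> = Sprod (shift (- int n) \<omega>) n"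

text \<open>Measurable substitutes for the representatives \<open>a\<close> and \<open>b\<close>, which need not be measurable:
  almost surely \<open>q \<omega> w = \<bar>b \<omega> \<bullet> w\<bar>\<close> and \<open>p \<omega> M = norm (M *v a \<omega>)\<close>.\<close>

definition q :: "(int \<Rightarrow> (real^'d^'d) \<times> (real^'d^'d)) \<Rightarrow> real^'d \<Rightarrow> real" where
  "q \<omega> w = lim (\<lambda>n. norm (Sprod \<omega> n *v w) / norm (Sprod \<omega> n))"

definition p :: "(int \<Rightarrow> (real^'d^'d) \<times> (real^'d^'d)) \<Rightarrow> real^'d^'d \<Rightarrow> real" where
  "p \<omega> M = lim (\<lambda>n. norm (M ** past_prod n \<omega>) / norm (past_prod n \<omega>))"

lemma fst_measurable [measurable]: "fst \<in> borel_measurable lam"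
  and snd_measurable [measurable]: "snd \<in> borel_measurable lam"
proof -
  have eq: "borel_measurable lam = (borel_measurable borel :: (_ \<Rightarrow> real^'d^'d) set)"
    by (rule measurable_cong_sets[OF sets_lam refl])
  show "fst \<in> borel_measurable lam" "snd \<in> borel_measurable lam" unfolding eq
    by (intro borel_measurable_continuous_onI continuous_intros)+
qed

lemma Acoef_measurable [measurable (raw)]:
  assumes "f \<in> measurable N P" shows "(\<lambda>x. Acoef (f x) n) \<in> borel_measurable N"
proof -
  have "(\<lambda>\<omega>. fst (\<omega> (n - 1))) \<in> borel_measurable P" by measurable
  from measurable_compose[OF assms this] show ?thesis by (simp add: Acoef_def)
qed

lemma Bcoef_measurable [measurable (raw)]:
  assumes "f \<in> measurable N P" shows "(\<lambda>x. Bcoef (f x) n) \<in> borel_measurable N"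
proof -
  have "(\<lambda>\<omega>. snd (\<omega> (n - 1))) \<in> borel_measurable P" by measurable
  from measurable_compose[OF assms this] show ?thesis by (simp add: Bcoef_def)
qed

lemma Sprod_measurable [measurable (raw)]:
  assumes [measurable]: "f \<in> measurable N P" shows "(\<lambda>x. Sprod (f x) n) \<in> borel_measurable N"
  by (induction n) (simp_all del: of_nat_Suc)

lemma past_prod_measurable [measurable (raw)]:
  assumes [measurable]: "f \<in> measurable N P" shows "(\<lambda>x. past_prod n (f x)) \<in> borel_measurable N"
  unfolding past_prod_def by measurable

lemma q_measurable [measurable (raw)]:
  assumes [measurable]: "f \<in> measurable N P" "g \<in> borel_measurable N"
  shows "(\<lambda>x. q (f x) (g x)) \<in> borel_measurable N"
  unfolding q_def by measurable

lemma p_measurable [measurable (raw)]: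
  assumes [measurable]: "f \<in> measurable N P" "g \<in> borel_measurable N"
  shows "(\<lambda>x. p (f x) (g x)) \<in> borel_measurable N"
  unfolding p_def by measurable

definition good_b :: "(int \<Rightarrow> (real^'d^'d) \<times> (real^'d^'d)) \<Rightarrow> bool" where
  "good_b \<omega> \<longleftrightarrow> norm (b \<omega>) = 1 \<and>
    (\<forall>w. (\<lambda>n. norm (Sprod \<omega> n *v w) / norm (Sprod \<omega> n)) \<longlonglongrightarrow> \<bar>b \<omega> \<bullet> w\<bar>)"

definition good_a :: "(int \<Rightarrow> (real^'d^'d) \<times> (real^'d^'d)) \<Rightarrow> bool" where
  "good_a \<omega> \<longleftrightarrow> norm (a \<omega>) = 1 \<and>
    (\<forall>M :: real^'d^'d. (\<lambda>n. norm (M ** past_prod n \<omega>) / norm (past_prod n \<omega>)) \<longlonglongrightarrow> norm (M *v a \<omega>))"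

lemma good_b_q: "good_b \<omega> \<Longrightarrow> q \<omega> w = \<bar>b \<omega> \<bullet> w\<bar>"
  unfolding good_b_def q_def by (blast intro: limI)

lemma good_a_p: "good_a \<omega> \<Longrightarrow> p \<omega> M = norm (M *v a \<omega>)"
  unfolding good_a_def p_def by (blast intro: limI)

lemma AE_good_b: "AE \<omega> in P. good_b \<omega>"
  using Zt
proof eventually_elim
  case (elim \<omega>)
  have "(\<lambda>n. norm (Sprod \<omega> n *v w) / norm (Sprod \<omega> n)) \<longlonglongrightarrow> \<bar>b \<omega> \<bullet> w\<bar>" for w
    using rank_one_limits_transpose_vec[of "Sstar \<omega>" "zt \<omega>" w] elim
    by (simp add: Sstar_eq_transpose b_def norm_transpose)
  then show ?case using elim unfolding good_b_def by (simp add: b_def)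
qed

lemma AE_good_a: "AE \<omega> in P. good_a \<omega>"
  using Z
proof eventually_elim
  case (elim \<omega>)
  have "(\<lambda>n. norm (M ** past_prod n \<omega>) / norm (past_prod n \<omega>)) \<longlonglongrightarrow> norm (M *v a \<omega>)" for M :: "real^'d^'d"
    using rank_one_limits_left_mult[of "\<lambda>n. past_prod n \<omega>" "z \<omega>" M] elim
    by (simp add: past_prod_def a_def)
  then show ?case using elim unfolding good_a_def by (simp add: a_def)
qed

section \<open>Equivariance of the limit directions\<close>

lemma AE_invertible: "AE \<omega> in P. \<forall>i. invertible (fst (\<omega> i))"
  unfolding AE_all_countable P_def using AE_PiM_component[of UNIV "\<lambda>_. lam"] prob_lam GL by auto

text \<open>\<open>Sprod \<omega> (n + m)\<close> is a product of n steps from time m on, applied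
  after \<open>Sprod \<omega> m\<close>, so the limit functionals at \<omega> and at the shifted
  point are proportional. The comparison is cross-multiplied, which needs no nonvanishing.\<close>

lemma b_cocycle:
  assumes good: "good_b \<omega>" "good_b (shift (int m) \<omega>)" and inv: "\<forall>i. invertible (fst (\<omega> i))"
  shows "\<exists>t>0. \<forall>w. \<bar>b (shift (int m) \<omega>) \<bullet> (Sprod \<omega> m *v w)\<bar> = t * \<bar>b \<omega> \<bullet> w\<bar>"
proof -
  let ?S = "Sprod \<omega> m" and ?b' = "b (shift (int m) \<omega>)"
  let ?X = "Sprod (shift (int m) \<omega>)" and ?Y = "\<lambda>n. Sprod \<omega> (n + m)"
  have Y: "?Y n = ?X n ** ?S" for n by (rule Sprod_add)
  have cross: "\<bar>b \<omega> \<bullet> w\<bar> * \<bar>?b' \<bullet> (?S *v w0)\<bar> = \<bar>b \<omega> \<bullet> w0\<bar> * \<bar>?b' \<bullet> (?S *v w)\<bar>" for w w0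
  proof -
    have lb: "(\<lambda>n. norm (?Y n *v w) / norm (?Y n)) \<longlonglongrightarrow> \<bar>b \<omega> \<bullet> w\<bar>" for w
      using good(1) LIMSEQ_ignore_initial_segment[of "\<lambda>n. norm (Sprod \<omega> n *v w) / norm (Sprod \<omega> n)" _ m]
      unfolding good_b_def by blast
    have lb': "(\<lambda>n. norm (?X n *v (?S *v w)) / norm (?X n)) \<longlonglongrightarrow> \<bar>?b' \<bullet> (?S *v w)\<bar>" for w
      using good(2) unfolding good_b_def by blast
    have 1: "(\<lambda>n. norm (?Y n *v w) / norm (?Y n) * (norm (?X n *v (?S *v w0)) / norm (?X n)))
      \<longlonglongrightarrow> \<bar>b \<omega> \<bullet> w\<bar> * \<bar>?b' \<bullet> (?S *v w0)\<bar>" by (intro tendsto_mult lb lb')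
    have eq: "norm (?Y n *v w) / norm (?Y n) * (norm (?X n *v (?S *v w0)) / norm (?X n))
      = norm (?Y n *v w0) / norm (?Y n) * (norm (?X n *v (?S *v w)) / norm (?X n))" for n
      by (simp add: Y matrix_vector_mul_assoc mult.commute)
    have 2: "(\<lambda>n. norm (?Y n *v w0) / norm (?Y n) * (norm (?X n *v (?S *v w)) / norm (?X n)))
      \<longlonglongrightarrow> \<bar>b \<omega> \<bullet> w0\<bar> * \<bar>?b' \<bullet> (?S *v w)\<bar>" by (intro tendsto_mult lb lb')
    show ?thesis by (rule LIMSEQ_unique[OF 1[unfolded eq] 2])
  qed
  have nb: "b \<omega> \<bullet> b \<omega> = 1" "?b' \<bullet> ?b' = 1"
    using good unfolding good_b_def by (auto simp: norm_eq_1)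
  have "invertible ?S" using invertible_Sprod inv by blast
  \<comment> \<open>The reference vector R b' is mapped to b' by the product, so its image pairs
    with b' to 1 and c becomes \<bar>b \<bullet> R b'\<bar>. Testing with w = b shows that c is not
    0.\<close>
  then obtain R where "?S ** R = mat 1" unfolding invertible_def by blast
  then have "?S *v (R *v ?b') = ?b'" by (simp add: matrix_vector_mul_assoc)
  then obtain c where eq: "\<And>w. \<bar>b \<omega> \<bullet> w\<bar> = c * \<bar>?b' \<bullet> (?S *v w)\<bar>" and c: "c \<ge> 0"
    using cross[of _ "R *v ?b'"] nb by (metis abs_1 abs_ge_zero mult.right_neutral)
  have "c \<noteq> 0" using eq[of "b \<omega>"] nb by auto
  with c show ?thesis by (intro exI[of _ "1 / c"]) (simp add: eq)
qed

lemma past_prod_shift: "past_prod (n + m) (shift (int m) \<omega>) = Sprod \<omega> m ** past_prod n \<omega>"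
  using Sprod_add[of "shift (- int n) \<omega>" m n] by (simp add: past_prod_def add.commute)

text \<open>The products ending at time m are \<open>Sprod \<omega> m\<close> times those ending at
  time 0. Multiplying by an arbitrary \<open>M\<close> and passing to the limit shows that
  \<open>a\<close> at the shifted point and the normalized image of \<open>a\<close> have the same
  norm under every \<open>M\<close>, hence agree up to sign.\<close>

lemma a_cocycle:
  assumes good: "good_a \<omega>" "good_a (shift (int m) \<omega>)" and inv: "\<forall>i. invertible (fst (\<omega> i))"
  shows "\<exists>s. \<bar>s\<bar> = norm (Sprod \<omega> m *v a \<omega>) \<and> Sprod \<omega> m *v a \<omega> = s *\<^sub>R a (shift (int m) \<omega>)"
proof -
  let ?S = "Sprod \<omega> m" and ?a' = "a (shift (int m) \<omega>)"
  let ?X = "\<lambda>n. past_prod n \<omega>" and ?Y = "\<lambda>n. past_prod (n + m) (shift (int m) \<omega>)"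
  have Y: "?Y n = ?S ** ?X n" for n by (rule past_prod_shift)
  have na: "norm (a \<omega>) = 1" "norm ?a' = 1" using good unfolding good_a_def by auto
  have "invertible ?S" using invertible_Sprod inv by blast
  then have S0: "?S *v a \<omega> \<noteq> 0" using na invertible_mult_vec_eq_0 by force
  have prod: "norm (M *v ?a') * norm (?S *v a \<omega>) = norm (M *v (?S *v a \<omega>))" for M :: "real^'d^'d"
  proof -
    have "(\<lambda>n. norm (M ** ?Y n) / norm (?Y n)) \<longlonglongrightarrow> norm (M *v ?a')"
      using good(2) LIMSEQ_ignore_initial_segment[of "\<lambda>n. norm (M ** past_prod n (shift (int m) \<omega>)) / norm (past_prod n (shift (int m) \<omega>))" _ m]
      unfolding good_a_def by blast
    moreover have la: "(\<lambda>n. norm (M ** ?X n) / norm (?X n)) \<longlonglongrightarrow> norm (M *v a \<omega>)" for M :: "real^'d^'d"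
      using good(1) unfolding good_a_def by blast
    ultimately have "(\<lambda>n. norm (M ** ?Y n) / norm (?Y n) * (norm (?S ** ?X n) / norm (?X n)))
      \<longlonglongrightarrow> norm (M *v ?a') * norm (?S *v a \<omega>)" by (intro tendsto_mult)
    moreover have "norm (M ** ?Y n) / norm (?Y n) * (norm (?S ** ?X n) / norm (?X n))
      = norm ((M ** ?S) ** ?X n) / norm (?X n)" for n
    proof (cases "?Y n = 0")
      case True
      then have "?S ** ?X n = 0" using Y by simp
      then have "(M ** ?S) ** ?X n = 0"
        using matrix_mult_scaleR_right[of M 0 0] by (simp add: matrix_mul_assoc[symmetric])
      then show ?thesis using True by simp
    qed (simp add: Y matrix_mul_assoc)
    ultimately have "(\<lambda>n. norm ((M ** ?S) ** ?X n) / norm (?X n)) \<longlonglongrightarrow> norm (M *v ?a') * norm (?S *v a \<omega>)"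
      by simp
    from LIMSEQ_unique[OF this la[of "M ** ?S"]] show ?thesis by (simp add: matrix_vector_mul_assoc)
  qed
  let ?e = "(?S *v a \<omega>) /\<^sub>R norm (?S *v a \<omega>)"
  have "?a' = ?e \<or> ?a' = - ?e"
  proof (rule unit_eq_up_to_sign_matrix)
    fix M :: "real^'d^'d"
    show "norm (M *v ?a') = norm (M *v ?e)"
      using prod[of M] S0 by (simp add: matrix_vector_mult_scaleR field_simps)
  qed (use na S0 in auto)
  then show ?thesis
  proof
    assume "?a' = ?e"
    then show ?thesis using S0 by (intro exI[of _ "norm (?S *v a \<omega>)"]) simp
  next
    assume "?a' = - ?e"
    then show ?thesis using S0 by (intro exI[of _ "- norm (?S *v a \<omega>)"]) simp
  qed
qed

section \<open>Dependence of the limit directions on past and future\<close>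

lemma past_prod_glue: "0 \<le> m \<Longrightarrow> past_prod n (glue m \<omega> \<omega>') = past_prod n \<omega>"
  unfolding past_prod_def by (rule Sprod_cong) (auto simp: shift_def glue_def)

lemma Sprod_shift_glue: "Sprod (shift m (glue m \<omega> \<omega>')) n = Sprod (shift m \<omega>') n"
  by (rule Sprod_cong) (auto simp: shift_def glue_def)

lemma q_shift_glue: "q (shift m (glue m \<omega> \<omega>')) w = q (shift m \<omega>') w"
  unfolding q_def Sprod_shift_glue ..

lemma p_glue: "0 \<le> m \<Longrightarrow> p (glue m \<omega> \<omega>') M = p \<omega> M"
  unfolding p_def by (simp add: past_prod_glue)

text \<open>\<open>z\<close> may be any choice of representative and may depend on all coordinates.
  Its direction is recovered from \<open>p\<close>, which only sees negative times, so changing the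
  future can only flip the sign.\<close>

lemma a_glue:
  assumes "0 \<le> m" "good_a \<omega>" "good_a (glue m \<omega> \<omega>')"
  shows "a (glue m \<omega> \<omega>') = a \<omega> \<or> a (glue m \<omega> \<omega>') = - a \<omega>"
proof (rule unit_eq_up_to_sign_matrix)
  fix M :: "real^'d^'d"
  show "norm (M *v a (glue m \<omega> \<omega>')) = norm (M *v a \<omega>)"
    using p_glue[OF assms(1), of \<omega> \<omega>' M] good_a_p assms(2,3) by simp
qed (use assms in \<open>auto simp: good_a_def\<close>)

section \<open>Non-degeneracy of the limit directions\<close>


lemma invariant_family_contradiction:
  assumes fin: "finite \<V>" "\<V> \<noteq> {}"
    and V: "\<And>V. V \<in> \<V> \<Longrightarrow> subspace V \<and> V \<noteq> {0} \<and> V \<noteq> UNIV \<and> dim V = k"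
    and AE: "AE \<omega> in P. \<forall>V\<in>\<V>. \<exists>W\<in>\<V>. \<forall>v\<in>V. Acoef \<omega> 1 *v v \<in> W"
  shows False
proof -
  let ?C = "{M :: real^'d^'d. \<forall>V\<in>\<V>. \<exists>W\<in>\<V>. \<forall>v\<in>V. M *v v \<in> W}"
  have "closed ?C" by (rule closed_maps_into[OF fin(1)]) (use V closed_subspace in auto)
  then have C [measurable]: "?C \<in> sets borel" by simp
  have lam: "distr P lam (\<lambda>\<omega>. \<omega> 0) = lam"
    unfolding P_def by (rule distr_PiM_component) (use prob_lam in auto)
  have "AE \<omega> in P. fst (\<omega> 0) \<in> ?C" using AE by (simp add: Acoef_def)
  then have "AE p in distr P lam (\<lambda>\<omega>. \<omega> 0). fst p \<in> ?C"
    by (subst AE_distr_iff) measurable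
  then have "AE p in lam. fst p \<in> ?C" by (simp only: lam)
  then have "AE M in law_A lam. M \<in> ?C"
    unfolding law_A_def by (subst AE_distr_iff) measurable
  then have "\<not> strongly_irreducible (law_A lam)"
    by (intro not_strongly_irreducible[OF _ fin V]) (auto simp: law_A_def)
  with irr show False by simp
qed

text \<open>A fixed finite spanning set turns orthogonality to a whole subspace into finitely many
  conditions, which keeps the events below measurable.\<close>

definition spanning :: "(real^'d) set \<Rightarrow> (real^'d) set" where
  "spanning U = (SOME B. finite B \<and> span B = U)"

lemma spanning:
  assumes "subspace U" shows "finite (spanning U)" "span (spanning U) = U"
proof -
  obtain B where "B \<subseteq> U" "independent B" "span B = U"
    using basis_exists[of U] assms by (metis span_subspace)
  then have "\<exists>B. finite B \<and> span B = U" using independent_bound by blast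
  from someI_ex[OF this] show "finite (spanning U)" "span (spanning U) = U" unfolding spanning_def by auto
qed

definition orth_event :: "(real^'d) set \<Rightarrow> (int \<Rightarrow> (real^'d^'d) \<times> (real^'d^'d)) set" where
  "orth_event U = {\<omega>. \<forall>v\<in>spanning U. q \<omega> v = 0}"

lemma sets_Ball_q:
  assumes "finite B" and [measurable]: "\<And>v. (\<lambda>x. g v x) \<in> borel_measurable N" "f \<in> measurable N P"
  shows "{x\<in>space N. \<forall>v\<in>B. q (f x) (g v x) = 0} \<in> sets N"
  by (rule sets.sets_Collect_finite_All[OF _ assms(1)]) measurable

lemma orth_event_sets: "subspace U \<Longrightarrow> orth_event U \<in> sets P"
  using sets_Ball_q[OF spanning(1), of U "\<lambda>v _. v" P "\<lambda>\<omega>. \<omega>"] by (simp add: orth_event_def)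

lemma orth_event_iff:
  assumes "good_b \<omega>" "subspace U"
  shows "\<omega> \<in> orth_event U \<longleftrightarrow> (\<forall>v\<in>U. b \<omega> \<bullet> v = 0)"
  using orthogonal_to_span_iff[of "spanning U" "b \<omega>"] spanning[OF assms(2)]
  by (simp add: orth_event_def good_b_q[OF assms(1)])

lemma b_step:
  assumes "good_b \<omega>" "good_b (shift 1 \<omega>)" "\<forall>i. invertible (fst (\<omega> i))"
  shows "b (shift 1 \<omega>) \<bullet> (Acoef \<omega> 1 *v v) = 0 \<longleftrightarrow> b \<omega> \<bullet> v = 0"
proof -
  obtain t where "t > 0" "\<bar>b (shift (int 1) \<omega>) \<bullet> (Sprod \<omega> 1 *v v)\<bar> = t * \<bar>b \<omega> \<bullet> v\<bar>"
    using b_cocycle[of \<omega> 1] assms by auto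
  then show ?thesis by auto
qed

text \<open>Stationarity of the law of \<open>b\<close>: by equivariance \<open>b \<omega>\<close>
  is orthogonal to \<open>U\<close> iff the next \<open>b\<close> is orthogonal to the image of
  \<open>U\<close> under the first matrix, and gluing at 1 separates that matrix from the next
  \<open>b\<close>.\<close>

lemma orth_event_stationary:
  assumes U: "subspace U"
  shows "emeasure P (orth_event U) = (\<integral>\<^sup>+\<omega>. emeasure P {\<omega>'. \<forall>v\<in>spanning U. q \<omega>' (Acoef \<omega> 1 *v v) = 0} \<partial>P)"
proof -
  note fin = spanning(1)[OF U]
  let ?Q = "\<lambda>\<omega>. \<forall>v\<in>spanning U. q (shift 1 \<omega>) (Acoef \<omega> 1 *v v) = 0"
  have Q: "{\<omega>. ?Q \<omega>} \<in> sets P"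
    using sets_Ball_q[OF fin, of "\<lambda>v \<omega>. Acoef \<omega> 1 *v v" P "shift 1"] by simp
  have "emeasure P (orth_event U) = emeasure P {\<omega>. ?Q \<omega>}"
  proof (rule emeasure_eq_AE[OF _ orth_event_sets[OF U] Q])
    show "AE \<omega> in P. \<omega> \<in> orth_event U \<longleftrightarrow> \<omega> \<in> {\<omega>. ?Q \<omega>}"
      using AE_good_b AE_shift[OF AE_good_b, of 1] AE_invertible
    proof eventually_elim
      case (elim \<omega>)
      then show ?case by (simp add: orth_event_def good_b_q b_step)
    qed
  qed
  also have "\<dots> = (\<integral>\<^sup>+\<omega>. emeasure P {\<omega>'. ?Q (glue 1 \<omega> \<omega>')} \<partial>P)" by (rule emeasure_glue[OF Q])
  also have "\<dots> = (\<integral>\<^sup>+\<omega>. emeasure P {\<omega>'. \<forall>v\<in>spanning U. q \<omega>' (Acoef \<omega> 1 *v v) = 0} \<partial>P)"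
  proof (rule nn_integral_cong)
    fix \<omega> :: "int \<Rightarrow> (real^'d^'d) \<times> (real^'d^'d)"
    have "Acoef (glue 1 \<omega> \<omega>') 1 = Acoef \<omega> 1" for \<omega>' by (simp add: Acoef_def)
    then show "emeasure P {\<omega>'. ?Q (glue 1 \<omega> \<omega>')} = emeasure P {\<omega>'. \<forall>v\<in>spanning U. q \<omega>' (Acoef \<omega> 1 *v v) = 0}"
      using emeasure_shift[of "\<lambda>\<omega>'. \<forall>v\<in>spanning U. q \<omega>' (Acoef \<omega> 1 *v v) = 0" 1]
        sets_Ball_q[OF fin, of "\<lambda>v _. Acoef \<omega> 1 *v v" P "\<lambda>\<omega>. \<omega>"]
      by (simp add: q_shift_glue)
  qed
  finally show ?thesis .
qed

text \<open>The image of the chosen spanning set of \<open>U\<close> and the spanning set chosen for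
  the image may differ, but they have the same span, so the two events agree wherever
  \<open>good_b\<close> holds.\<close>

lemma orth_event_image:
  assumes U: "subspace U"
  shows "P.prob {\<omega>'. \<forall>v\<in>spanning U. q \<omega>' (M *v v) = 0} = P.prob (orth_event ((\<lambda>v. M *v v) ` U))"
proof (rule measure_eq_AE)
  have W: "subspace ((\<lambda>v. M *v v) ` U)" by (rule linear_subspace_image[OF _ U]) simp
  have W_span: "(\<lambda>v. M *v v) ` U = span ((\<lambda>v. M *v v) ` spanning U)"
    using linear_span_image[of "\<lambda>v. M *v v" "spanning U"] spanning(2)[OF U] by simp
  show "AE \<omega>' in P. \<omega>' \<in> {\<omega>'. \<forall>v\<in>spanning U. q \<omega>' (M *v v) = 0} \<longleftrightarrow> \<omega>' \<in> orth_event ((\<lambda>v. M *v v) ` U)"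
    using AE_good_b
  proof eventually_elim
    case (elim \<omega>')
    show ?case unfolding orth_event_iff[OF elim W]
      by (subst W_span) (simp add: orthogonal_to_span_iff good_b_q[OF elim])
  qed
  show "{\<omega>'. \<forall>v\<in>spanning U. q \<omega>' (M *v v) = 0} \<in> sets P"
    using sets_Ball_q[OF spanning(1)[OF U], of "\<lambda>v _. M *v v" P "\<lambda>\<omega>. \<omega>"] by simp
  show "orth_event ((\<lambda>v. M *v v) ` U) \<in> sets P" by (rule orth_event_sets[OF W])
qed

text \<open>Two different subspaces of dimension k span one of larger dimension, so orthogonality to
  both has probability 0. The events are almost surely disjoint with probability at least e each,
  hence at most 1/e in number.\<close>

lemma finite_large_orth_events:
  assumes k: "\<And>U. subspace U \<Longrightarrow> k < dim U \<Longrightarrow> P.prob (orth_event U) = 0" and e: "e > 0"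
  shows "finite {U. subspace U \<and> dim U = k \<and> e \<le> P.prob (orth_event U)}" (is "finite ?F")
proof -
  have "card G \<le> nat \<lceil>1 / e\<rceil>" if G: "G \<subseteq> ?F" "finite G" for G
  proof -
    have "(\<Sum>U\<in>G. e) \<le> (\<Sum>U\<in>G. P.prob (orth_event U))" using G by (intro sum_mono) auto
    also have "\<dots> = P.prob (\<Union>U\<in>G. orth_event U)"
    proof (rule measure_UNION_AE[symmetric, OF G(2)])
      show "U \<in> G \<Longrightarrow> orth_event U \<in> fmeasurable P" for U
        using G orth_event_sets by (auto simp: P.fmeasurable_eq_sets)
      show "pairwise (\<lambda>U V. AE \<omega> in P. \<omega> \<notin> orth_event U \<or> \<omega> \<notin> orth_event V) G"
      proof (rule pairwiseI)
        fix U V assume UV: "U \<in> G" "V \<in> G" "U \<noteq> V"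
        then have U: "subspace U" "dim U = k" and V: "subspace V" "dim V = k" using G by auto
        let ?W = "span (U \<union> V)"
        have "k < dim ?W"
        proof (rule ccontr)
          assume "\<not> k < dim ?W"
          then have "U = ?W"
            by (intro subspace_dim_equal[OF U(1) subspace_span]) (use U in \<open>auto intro: span_base\<close>)
          moreover have "V = ?W" using \<open>\<not> k < dim ?W\<close>
            by (intro subspace_dim_equal[OF V(1) subspace_span]) (use V in \<open>auto intro: span_base\<close>)
          ultimately have "U = V" by simp
          with UV show False by simp
        qed
        then have "P.prob (orth_event ?W) = 0" by (intro k) auto
        then have "AE \<omega> in P. \<omega> \<notin> orth_event ?W"
          using orth_event_sets[of ?W] by (simp add: P.prob_eq_0)
        then show "AE \<omega> in P. \<omega> \<notin> orth_event U \<or> \<omega> \<notin> orth_event V"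
          using AE_good_b
        proof eventually_elim
          case (elim \<omega>)
          have "\<not> (\<forall>v\<in>U \<union> V. b \<omega> \<bullet> v = 0)"
            using elim(1) unfolding orth_event_iff[OF elim(2) subspace_span] orthogonal_to_span_iff .
          then show ?case using orth_event_iff[OF elim(2) U(1)] orth_event_iff[OF elim(2) V(1)] by blast
        qed
      qed
    qed
    also have "\<dots> \<le> 1" by (rule P.prob_le_1)
    finally have "real (card G) \<le> 1 / e" using e by (simp add: field_simps)
    then show ?thesis by linarith
  qed
  then show ?thesis using finite_if_finite_subsets_card_bdd by blast
qed

text \<open>Furstenberg's argument: the subspaces of maximal dimension that are orthogonal to \<open>b\<close> with
  maximal positive probability form a finite family which \<open>A\<^sub>1\<close> maps to itself.\<close>

lemma b_nonorthogonal:
  assumes x: "x \<noteq> 0" shows "AE \<omega> in P. b \<omega> \<bullet> x \<noteq> 0"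
proof (rule ccontr)
  assume neg: "\<not> ?thesis"
  let ?m = "\<lambda>U. P.prob (orth_event U)"
  have pos1: "?m (span {x}) > 0"
  proof (rule ccontr)
    assume "\<not> ?thesis"
    then have "?m (span {x}) = 0" by (simp add: antisym)
    then have "AE \<omega> in P. \<omega> \<notin> orth_event (span {x})"
      using orth_event_sets[of "span {x}"] by (simp add: P.prob_eq_0)
    then have "AE \<omega> in P. b \<omega> \<bullet> x \<noteq> 0" using AE_good_b
      by eventually_elim (simp add: orth_event_iff orthogonal_to_span_iff)
    with neg show False by simp
  qed
  define D where "D = {dim U | U :: (real^'d) set. subspace U \<and> ?m U > 0}"
  have "D \<subseteq> {..CARD('d)}" unfolding D_def using dim_subset_UNIV_cart by auto
  then have D: "finite D" "dim (span {x}) \<in> D"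
    using finite_subset[of D] pos1 subspace_span[of "{x}"] unfolding D_def by (auto simp del: dim_span)
  define k where "k = Max D"
  have "k \<in> D" unfolding k_def using D by (intro Max_in) auto
  then obtain U1 where U1: "subspace U1" "dim U1 = k" "?m U1 > 0" unfolding D_def by auto
  have k1: "k \<ge> 1" using Max_ge[OF D] x unfolding k_def by (simp add: dim_insert)
  have kmax: "?m U = 0" if "subspace U" "k < dim U" for U
  proof (rule ccontr)
    assume "?m U \<noteq> 0"
    then have "dim U \<in> D" unfolding D_def using that by (auto simp: zero_less_measure_iff)
    then show False using Max_ge[OF D(1)] that unfolding k_def by force
  qed
  \<comment> \<open>Finiteness needs a positive threshold. The level of \<open>U1\<close> provides
    one, and the maximum \<open>c\<close> over the finite family \<open>F\<close> then bounds all
    subspaces of dimension k.\<close>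
  define F where "F = {U. subspace U \<and> dim U = k \<and> ?m U1 \<le> ?m U}"
  have F: "finite F" "U1 \<in> F"
    unfolding F_def using finite_large_orth_events[OF kmax U1(3)] U1 by auto
  define c where "c = Max (?m ` F)"
  define \<V> where "\<V> = {U\<in>F. ?m U = c}"
  have "c \<in> ?m ` F" unfolding c_def using F by (intro Max_in) auto
  then have ne: "\<V> \<noteq> {}" unfolding \<V>_def by auto
  have c_ge: "?m U1 \<le> c" unfolding c_def using F by (intro Max_ge) auto
  have le_c: "?m U \<le> c" if "subspace U" "dim U = k" for U
  proof (cases "U \<in> F")
    case True then show ?thesis unfolding c_def using F by (intro Max_ge) auto
  next
    case False then show ?thesis using c_ge that unfolding F_def by auto
  qed
  have in_V: "U \<in> \<V> \<longleftrightarrow> subspace U \<and> dim U = k \<and> ?m U = c" for U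
    unfolding \<V>_def F_def using c_ge by auto
  have fin: "finite \<V>" unfolding \<V>_def using F by simp
  show False
  proof (rule invariant_family_contradiction[OF fin ne])
    fix V assume V: "V \<in> \<V>"
    have "V \<noteq> UNIV"
    proof
      assume VU: "V = UNIV"
      have "AE \<omega> in P. \<omega> \<notin> orth_event V"
        using AE_good_b
      proof eventually_elim
        case (elim \<omega>)
        have "b \<omega> \<bullet> b \<omega> = 1" using elim by (simp add: good_b_def norm_eq_1)
        then show ?case unfolding orth_event_iff[OF elim, of V, unfolded VU, OF subspace_UNIV] VU
          by (metis UNIV_I orth_event_iff elim subspace_UNIV zero_neq_one)
      qed
      then have "?m V = 0" using P.prob_eq_0[OF orth_event_sets[of V]] V in_V by blast
      then show False using V in_V c_ge U1 by auto
    qed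
    moreover have "V \<noteq> {0}" using V in_V k1 by auto
    ultimately show "subspace V \<and> V \<noteq> {0} \<and> V \<noteq> UNIV \<and> dim V = k" using V in_V by auto
  next
    have "AE \<omega> in P. \<exists>W\<in>\<V>. \<forall>v\<in>V. Acoef \<omega> 1 *v v \<in> W" if "V \<in> \<V>" for V
    proof -
      have V: "subspace V" "dim V = k" "?m V = c" using that in_V by auto
      define f where "f \<omega> = P.prob {\<omega>'. \<forall>v\<in>spanning V. q \<omega>' (Acoef \<omega> 1 *v v) = 0}" for \<omega>
      let ?Q = "{x\<in>space (P \<Otimes>\<^sub>M P). \<forall>v\<in>spanning V. q (snd x) (Acoef (fst x) 1 *v v) = 0}"
      have "?Q \<in> sets (P \<Otimes>\<^sub>M P)"
        by (rule sets_Ball_q[OF spanning(1)[OF V(1)]]) measurable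
      from P.measurable_emeasure_Pair[OF this]
      have "(\<lambda>\<omega>. emeasure P {\<omega>'. \<forall>v\<in>spanning V. q \<omega>' (Acoef \<omega> 1 *v v) = 0}) \<in> borel_measurable P"
        by (simp add: vimage_def space_pair_measure)
      then have fm: "f \<in> borel_measurable P" unfolding f_def measure_def by measurable
      have f_img: "f \<omega> = ?m ((\<lambda>v. Acoef \<omega> 1 *v v) ` V)" for \<omega>
        unfolding f_def by (rule orth_event_image[OF V(1)])
      have img: "AE \<omega> in P. subspace ((\<lambda>v. Acoef \<omega> 1 *v v) ` V) \<and> dim ((\<lambda>v. Acoef \<omega> 1 *v v) ` V) = k"
        using AE_invertible
      proof eventually_elim
        case (elim \<omega>)
        then have inv: "invertible (Acoef \<omega> 1)" by (simp add: Acoef_def)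
        have "inj_on (\<lambda>v. Acoef \<omega> 1 *v v) (span V)"
          by (rule inj_on_subset[OF inj_mult_vec[OF inv] subset_UNIV])
        then have "dim ((\<lambda>v. Acoef \<omega> 1 *v v) ` V) = dim V" by (intro dim_image_eq) simp
        then show ?case using V linear_subspace_image[of "\<lambda>v. Acoef \<omega> 1 *v v"] by simp
      qed
      \<comment> \<open>By stationarity \<open>f\<close> has mean \<open>c\<close>, and it is the
        probability for the image of \<open>V\<close>, which is at most \<open>c\<close> since the
        image again has dimension k.\<close>
      have "AE \<omega> in P. f \<omega> = c"
      proof (rule P.AE_eq_of_nn_integral_eq[OF fm])
        show "AE \<omega> in P. f \<omega> \<le> c" using img by eventually_elim (simp add: f_img le_c)
        show "(\<integral>\<^sup>+\<omega>. f \<omega> \<partial>P) = ennreal c"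
          using orth_event_stationary[OF V(1)] V(3) by (simp add: f_def P.emeasure_eq_measure)
        show "0 \<le> c" using c_ge measure_nonneg order_trans by blast
      qed (simp add: f_def)
      then show ?thesis using img
      proof eventually_elim
        case (elim \<omega>)
        then have "(\<lambda>v. Acoef \<omega> 1 *v v) ` V \<in> \<V>" by (simp add: in_V f_img)
        then show ?case by blast
      qed
    qed
    then show "AE \<omega> in P. \<forall>V\<in>\<V>. \<exists>W\<in>\<V>. \<forall>v\<in>V. Acoef \<omega> 1 *v v \<in> W"
      using fin by (simp add: AE_ball_countable countable_finite)
  qed
qed

text \<open>The vectors almost surely orthogonal to \<open>a\<close> form a subspace
  \<open>N\<close>. By equivariance \<open>a\<close> is also orthogonal to the transposed first
  matrix applied to a vector of \<open>N\<close>; that matrix belongs to the future and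
  \<open>a\<close> to the past, so it can be frozen, and its transpose preserves \<open>N\<close>.
  The orthogonal complement of \<open>N\<close> is then a single invariant subspace, neither zero
  nor everything.\<close>

lemma a_not_in_hyperplane:
  assumes y: "y \<noteq> 0" shows "\<not> (AE \<omega> in P. a \<omega> \<bullet> y = 0)"
proof
  assume ay: "AE \<omega> in P. a \<omega> \<bullet> y = 0"
  define N where "N = {y. AE \<omega> in P. a \<omega> \<bullet> y = 0}"
  have N: "subspace N"
    unfolding subspace_def
  proof (intro conjI ballI allI)
    show "0 \<in> N" by (simp add: N_def)
    show "x + y \<in> N" if "x \<in> N" "y \<in> N" for x y
      using that unfolding N_def mem_Collect_eq by eventually_elim (simp add: inner_add_right)
    show "c *\<^sub>R x \<in> N" if "x \<in> N" for c x
      using that unfolding N_def mem_Collect_eq by eventually_elim simp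
  qed
  have step: "AE \<omega>' in P. transpose (Acoef \<omega>' 1) *v y \<in> N" if "y \<in> N" for y
  proof -
    have "AE \<omega> in P. a \<omega> \<bullet> y = 0" using that by (simp add: N_def)
    from AE_shift[OF this, of 1] AE_good_a AE_shift[OF AE_good_a, of 1] AE_invertible
    have "AE \<omega> in P. good_a \<omega> \<and> a \<omega> \<bullet> (transpose (Acoef \<omega> 1) *v y) = 0"
    proof eventually_elim
      case (elim \<omega>)
      obtain s where "Sprod \<omega> 1 *v a \<omega> = s *\<^sub>R a (shift 1 \<omega>)"
        using a_cocycle[of \<omega> 1] elim by auto
      then have "(Acoef \<omega> 1 *v a \<omega>) \<bullet> y = 0" using elim(1) by simp
      then show ?case using elim(2) by (metis dot_lmul_matrix inner_commute transpose_matrix_vector)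
    qed
    from AE_glue_swap[OF this, of 0]
    show ?thesis
    proof eventually_elim
      case (elim \<omega>')
      from elim AE_good_a
      have "AE \<omega> in P. a \<omega> \<bullet> (transpose (Acoef \<omega>' 1) *v y) = 0"
      proof eventually_elim
        case (elim \<omega>)
        have "Acoef (glue 0 \<omega> \<omega>') 1 = Acoef \<omega>' 1" by (simp add: Acoef_def)
        then show ?case using elim a_glue[of 0 \<omega> \<omega>'] by auto
      qed
      then show ?case by (simp add: N_def)
    qed
  qed
  have "AE \<omega>' in P. \<forall>y\<in>spanning N. transpose (Acoef \<omega>' 1) *v y \<in> N"
    using spanning[OF N] step span_base by (subst AE_ball_countable) (auto intro: countable_finite)
  then have inv: "AE \<omega>' in P. \<forall>y\<in>N. transpose (Acoef \<omega>' 1) *v y \<in> N"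
  proof eventually_elim
    case (elim \<omega>')
    have "subspace {y. transpose (Acoef \<omega>' 1) *v y \<in> N}"
      using linear_subspace_vimage[OF _ N, of "\<lambda>y. transpose (Acoef \<omega>' 1) *v y"]
      by (simp add: vimage_def del: transpose_matrix_vector)
    then have "span (spanning N) \<subseteq> {y. transpose (Acoef \<omega>' 1) *v y \<in> N}"
      using elim by (intro span_minimal) auto
    then show ?case using spanning(2)[OF N] by auto
  qed
  define V where "V = {v. \<forall>y\<in>N. v \<bullet> y = 0}"
  have V: "subspace V" unfolding V_def subspace_def by (auto simp: inner_add_left)
  have "N \<noteq> UNIV"
  proof
    assume "N = UNIV"
    then have "AE \<omega> in P. \<forall>y\<in>Basis. a \<omega> \<bullet> y = 0"
      by (subst AE_ball_countable) (auto simp: N_def countable_finite)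
    then have "AE \<omega> in P. False"
      using AE_good_a
    proof eventually_elim
      case (elim \<omega>)
      then have "a \<omega> = 0" by (simp add: euclidean_all_zero_iff)
      with elim show ?case by (simp add: good_a_def)
    qed
    then show False by simp
  qed
  then obtain v where v: "v \<noteq> 0" "\<And>y. y \<in> span N \<Longrightarrow> orthogonal v y"
    using orthogonal_to_subspace_exists_gen[of N UNIV] span_eq_iff N by (metis UNIV_I psubsetI span_UNIV subset_UNIV)
  have "v \<in> V" unfolding V_def using v(2) span_base by (auto simp: orthogonal_def)
  have "V \<noteq> UNIV"
  proof
    assume "V = UNIV"
    then have "y \<in> V" by simp
    moreover have "y \<in> N" using ay by (simp add: N_def)
    ultimately have "y \<bullet> y = 0" unfolding V_def by blast
    then show False using y by simp
  qed
  have "AE \<omega> in P. \<forall>v\<in>V. Acoef \<omega> 1 *v v \<in> V"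
    using inv
  proof eventually_elim
    case (elim \<omega>)
    have "(Acoef \<omega> 1 *v v) \<bullet> y = v \<bullet> (transpose (Acoef \<omega> 1) *v y)" for v y
      by (metis dot_lmul_matrix inner_commute transpose_matrix_vector)
    then show ?case using elim unfolding V_def by auto
  qed
  then have "AE \<omega> in P. \<forall>V'\<in>{V}. \<exists>W\<in>{V}. \<forall>v\<in>V'. Acoef \<omega> 1 *v v \<in> W" by simp
  from invariant_family_contradiction[OF _ _ _ this, of "dim V"]
  show False using V \<open>v \<in> V\<close> v(1) \<open>V \<noteq> UNIV\<close> by auto
qed

section \<open>The maximal inequality\<close>


text \<open>Compactness of the sphere makes \<open>b_nonorthogonal\<close> uniform: if the bound
  failed, violating unit vectors for levels tending to 0 would accumulate at some \<open>l\<close>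
  with \<open>q \<omega> l = 0\<close> almost surely.\<close>

lemma b_unit_spread:
  "\<exists>c>0. \<forall>v. norm v = 1 \<longrightarrow> c \<le> P.prob {\<omega>. c \<le> q \<omega> v}"
proof (rule ccontr)
  assume "\<not> ?thesis"
  then have neg: "\<exists>v. norm v = 1 \<and> P.prob {\<omega>. c \<le> q \<omega> v} < c" if "c > 0" for c
    using that by (auto simp: not_le)
  define d where "d n = 1 / real (Suc n)" for n
  have d: "d n > 0" for n by (simp add: d_def)
  have "\<forall>n. \<exists>v. norm v = 1 \<and> P.prob {\<omega>. d n \<le> q \<omega> v} < d n" using neg d by blast
  then obtain v where v: "\<And>n. norm (v n) = 1" "\<And>n. P.prob {\<omega>. d n \<le> q \<omega> (v n)} < d n" by metis
  have "compact (sphere (0 :: real^'d) 1)" by simp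
  moreover have "\<forall>n. v n \<in> sphere 0 1" using v by simp
  ultimately obtain l r where l: "l \<in> sphere 0 1" "strict_mono (r :: nat \<Rightarrow> nat)" "(v \<circ> r) \<longlonglongrightarrow> l"
    unfolding compact_def by blast
  have "l \<noteq> 0" using l(1) by auto
  have d0: "d \<longlonglongrightarrow> 0" unfolding d_def by real_asymp
  have dr: "(\<lambda>n. d (r n)) \<longlonglongrightarrow> 0" using LIMSEQ_subseq_LIMSEQ[OF d0 l(2)] by (simp add: comp_def)
  have vr: "(\<lambda>n. norm (v (r n) - l)) \<longlonglongrightarrow> 0"
    using l(3) by (simp add: LIM_zero_iff tendsto_norm_zero comp_def)
  have [measurable]: "{\<omega>. e \<le> q \<omega> w} \<in> sets P" for e w
  proof -
    have "{\<omega>\<in>space P. e \<le> q \<omega> w} \<in> sets P" by measurable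
    then show ?thesis by simp
  qed
  \<comment> \<open>The factor 2 absorbs the move from \<open>l\<close> to \<open>v (r n)\<close>:
    their distance is eventually below \<open>d k\<close>, and so is \<open>d (r n)\<close>.\<close>
  have null: "AE \<omega> in P. \<not> (2 * d k \<le> q \<omega> l)" for k
  proof -
    have "\<forall>\<^sub>F n in sequentially. P.prob {\<omega>. 2 * d k \<le> q \<omega> l} \<le> d (r n)"
      using order_tendstoD(2)[OF dr d[of k]] order_tendstoD(2)[OF vr d[of k]]
    proof eventually_elim
      case (elim n)
      have "P.prob {\<omega>. 2 * d k \<le> q \<omega> l} \<le> P.prob {\<omega>. d (r n) \<le> q \<omega> (v (r n))}"
      proof (rule P.finite_measure_mono_AE)
        show "AE \<omega> in P. \<omega> \<in> {\<omega>. 2 * d k \<le> q \<omega> l} \<longrightarrow> \<omega> \<in> {\<omega>. d (r n) \<le> q \<omega> (v (r n))}"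
          using AE_good_b
        proof eventually_elim
          case g: (elim \<omega>)
          have "\<bar>b \<omega> \<bullet> (v (r n) - l)\<bar> \<le> norm (b \<omega>) * norm (v (r n) - l)" by (rule Cauchy_Schwarz_ineq2)
          also have "\<dots> < d k" using g elim by (simp add: good_b_def)
          finally show ?case using elim by (auto simp: good_b_q[OF g] inner_diff_right)
        qed
      qed measurable
      also have "\<dots> < d (r n)" by (rule v)
      finally show ?case by simp
    qed
    then have "P.prob {\<omega>. 2 * d k \<le> q \<omega> l} \<le> 0"
      by (intro tendsto_lowerbound[OF dr]) auto
    then have "P.prob {\<omega>. 2 * d k \<le> q \<omega> l} = 0" by (simp add: antisym)
    then show ?thesis by (subst (asm) P.prob_eq_0) auto
  qed
  have "AE \<omega> in P. \<forall>k. \<not> (2 * d k \<le> q \<omega> l)" using null by (simp add: AE_all_countable)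
  then have "AE \<omega> in P. False"
    using AE_good_b b_nonorthogonal[OF \<open>l \<noteq> 0\<close>]
  proof eventually_elim
    case (elim \<omega>)
    have "\<forall>\<^sub>F k in sequentially. d k < \<bar>b \<omega> \<bullet> l\<bar> / 2"
      using order_tendstoD(2)[OF d0, of "\<bar>b \<omega> \<bullet> l\<bar> / 2"] elim(3) by simp
    then obtain k where "d k < \<bar>b \<omega> \<bullet> l\<bar> / 2" by (auto simp: eventually_sequentially)
    with elim(1)[rule_format, of k] show ?case by (simp add: good_b_q[OF elim(2)])
  qed
  then show False by simp
qed

lemma b_spread:
  "\<exists>c>0. \<forall>w. w \<noteq> 0 \<longrightarrow> c \<le> P.prob {\<omega>. c * norm w \<le> q \<omega> w}"
proof -
  obtain c where c: "c > 0" "\<And>v. norm v = 1 \<Longrightarrow> c \<le> P.prob {\<omega>. c \<le> q \<omega> v}"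
    using b_unit_spread by blast
  have "c \<le> P.prob {\<omega>. c * norm w \<le> q \<omega> w}" if w: "w \<noteq> 0" for w
  proof -
    have "c \<le> P.prob {\<omega>. c \<le> q \<omega> (w /\<^sub>R norm w)}" using w by (intro c) simp
    also have "\<dots> = P.prob {\<omega>. c * norm w \<le> q \<omega> w}"
    proof (rule measure_eq_AE)
      show "AE \<omega> in P. \<omega> \<in> {\<omega>. c \<le> q \<omega> (w /\<^sub>R norm w)} \<longleftrightarrow> \<omega> \<in> {\<omega>. c * norm w \<le> q \<omega> w}"
        using AE_good_b
        by eventually_elim (use w in \<open>simp add: good_b_q abs_mult field_simps\<close>)
      have "{\<omega>\<in>space P. c \<le> q \<omega> (w /\<^sub>R norm w)} \<in> sets P" by measurable
      then show "{\<omega>. c \<le> q \<omega> (w /\<^sub>R norm w)} \<in> sets P" by simp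
      have "{\<omega>\<in>space P. c * norm w \<le> q \<omega> w} \<in> sets P" by measurable
      then show "{\<omega>. c * norm w \<le> q \<omega> w} \<in> sets P" by simp
    qed
    finally show ?thesis .
  qed
  with c(1) show ?thesis by blast
qed

text \<open>A first-passage argument: at the first time \<open>m\<close> with \<open>t * norm (S\<^sub>m u) < norm (S\<^sub>m v)\<close> the
  future direction \<open>b\<close> is still independent of the past, so with probability at least \<open>c\<close> it sees a
  proportion \<open>c\<close> of \<open>S\<^sub>m v\<close>; by equivariance the limiting ratio \<open>q v / q u\<close> is then large as well.\<close>

lemma maximal_inequality:
  assumes c: "c > 0" "\<And>w. w \<noteq> 0 \<Longrightarrow> c \<le> P.prob {\<omega>. c * norm w \<le> q \<omega> w}" and t: "0 \<le> t"
  shows "ennreal c * emeasure P {\<omega>. \<exists>m. t * norm (Sprod \<omega> m *v u) < norm (Sprod \<omega> m *v v)}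
    \<le> emeasure P {\<omega>. c * t * q \<omega> u < q \<omega> v}"
proof -
  let ?R = "\<lambda>m \<omega>. t * norm (Sprod \<omega> m *v u) < norm (Sprod \<omega> m *v v)"
  define E where "E m = {\<omega>. ?R m \<omega> \<and> (\<forall>j<m. \<not> ?R j \<omega>)}" for m :: nat
  define G where "G m = {\<omega>. c * norm (Sprod \<omega> m *v v) \<le> q (shift (int m) \<omega>) (Sprod \<omega> m *v v)}" for m :: nat
  have E_sets [measurable]: "E m \<in> sets P" for m
  proof -
    have "{\<omega>\<in>space P. ?R m \<omega> \<and> (\<forall>j<m. \<not> ?R j \<omega>)} \<in> sets P" by measurable
    then show ?thesis by (simp add: E_def)
  qed
  have G_sets [measurable]: "G m \<in> sets P" for m
  proof -
    have "{\<omega>\<in>space P. c * norm (Sprod \<omega> m *v v) \<le> q (shift (int m) \<omega>) (Sprod \<omega> m *v v)} \<in> sets P" by measurable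
    then show ?thesis by (simp add: G_def)
  qed
  have disj: "disjoint_family E"
    unfolding disjoint_family_on_def E_def by (auto simp: set_eq_iff) (metis linorder_neqE_nat)
  have union: "{\<omega>. \<exists>m. ?R m \<omega>} = (\<Union>m. E m)"
    unfolding E_def using exists_least_iff[of "\<lambda>m. ?R m _"] by auto
  \<comment> \<open>\<open>E m\<close> depends only on coordinates before m, and with these frozen
    \<open>G m\<close> concerns only those from m on. The strict inequality at the passage time
    makes \<open>Sprod \<omega> m *v v\<close> nonzero, so the hypothesis on \<open>c\<close>
    applies to it.\<close>
  have step: "ennreal c * emeasure P (E m) \<le> emeasure P (E m \<inter> G m)" for m
  proof -
    let ?Q = "\<lambda>\<omega>. \<omega> \<in> E m \<and> \<omega> \<in> G m"
    have Q: "{\<omega>. ?Q \<omega>} \<in> sets P" using sets.Int[OF E_sets G_sets] by (simp add: Int_def)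
    have "ennreal c * emeasure P (E m) = (\<integral>\<^sup>+\<omega>. ennreal c * indicator (E m) \<omega> \<partial>P)"
      by (simp add: nn_integral_cmult)
    also have "\<dots> \<le> (\<integral>\<^sup>+\<omega>. emeasure P {\<omega>'. ?Q (glue (int m) \<omega> \<omega>')} \<partial>P)"
    proof (rule nn_integral_mono)
      fix \<omega> :: "int \<Rightarrow> (real^'d^'d) \<times> (real^'d^'d)"
      have S: "Sprod (glue (int m) \<omega> \<omega>') j = Sprod \<omega> j" if "j \<le> m" for j \<omega>'
        by (rule Sprod_cong) (use that in auto)
      have E: "glue (int m) \<omega> \<omega>' \<in> E m \<longleftrightarrow> \<omega> \<in> E m" for \<omega>'
        by (auto simp: E_def S)
      let ?w = "Sprod \<omega> m *v v"
      have G: "glue (int m) \<omega> \<omega>' \<in> G m \<longleftrightarrow> c * norm ?w \<le> q (shift (int m) \<omega>') ?w" for \<omega>'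
        by (simp add: G_def S q_shift_glue)
      show "ennreal c * indicator (E m) \<omega> \<le> emeasure P {\<omega>'. ?Q (glue (int m) \<omega> \<omega>')}"
      proof (cases "\<omega> \<in> E m")
        case True
        then have "t * norm (Sprod \<omega> m *v u) < norm ?w" by (simp add: E_def)
        moreover have "0 \<le> t * norm (Sprod \<omega> m *v u)" using t by simp
        ultimately have "norm ?w > 0" by linarith
        then have "ennreal c \<le> emeasure P {\<omega>'. c * norm ?w \<le> q \<omega>' ?w}"
          using c(2)[of ?w] by (simp add: P.emeasure_eq_measure)
        also have "\<dots> = emeasure P {\<omega>'. c * norm ?w \<le> q (shift (int m) \<omega>') ?w}"
        proof (rule emeasure_shift[symmetric])
          have "{\<omega>'\<in>space P. c * norm ?w \<le> q \<omega>' ?w} \<in> sets P" by measurable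
          then show "{\<omega>'. c * norm ?w \<le> q \<omega>' ?w} \<in> sets P" by simp
        qed
        finally show ?thesis using True by (simp add: E G)
      qed simp
    qed
    also have "\<dots> = emeasure P {\<omega>. ?Q \<omega>}" by (rule emeasure_glue[OF Q, symmetric])
    finally show ?thesis by (simp add: Int_def)
  qed
  have "ennreal c * emeasure P {\<omega>. \<exists>m. ?R m \<omega>} = ennreal c * (\<Sum>m. emeasure P (E m))"
    unfolding union by (subst suminf_emeasure) (use disj in auto)
  also have "\<dots> = (\<Sum>m. ennreal c * emeasure P (E m))" by (rule ennreal_suminf_cmult[symmetric])
  also have "\<dots> \<le> (\<Sum>m. emeasure P (E m \<inter> G m))"
    by (intro suminf_le step) auto
  also have "\<dots> = emeasure P (\<Union>m. E m \<inter> G m)"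
    by (rule suminf_emeasure) (use disj in \<open>auto simp: disjoint_family_on_def\<close>)
  also have "\<dots> \<le> emeasure P {\<omega>. c * t * q \<omega> u < q \<omega> v}"
  proof (rule emeasure_mono_AE)
    show "AE \<omega> in P. \<omega> \<in> (\<Union>m. E m \<inter> G m) \<longrightarrow> \<omega> \<in> {\<omega>. c * t * q \<omega> u < q \<omega> v}"
      using AE_good_b AE_shift_nat[OF AE_good_b] AE_invertible
    proof eventually_elim
      case (elim \<omega>)
      show ?case
      proof
        assume "\<omega> \<in> (\<Union>m. E m \<inter> G m)"
        then obtain m where m: "?R m \<omega>" "c * norm (Sprod \<omega> m *v v) \<le> q (shift (int m) \<omega>) (Sprod \<omega> m *v v)"
          unfolding E_def G_def by blast
        have gm: "good_b (shift (int m) \<omega>)" using elim by blast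
        obtain s where s: "s > 0" "\<And>w. \<bar>b (shift (int m) \<omega>) \<bullet> (Sprod \<omega> m *v w)\<bar> = s * \<bar>b \<omega> \<bullet> w\<bar>"
          using b_cocycle[OF elim(1) gm elim(3)] by blast
        have "s * q \<omega> u = \<bar>b (shift (int m) \<omega>) \<bullet> (Sprod \<omega> m *v u)\<bar>" by (simp add: s good_b_q[OF elim(1)])
        also have "\<dots> \<le> norm (Sprod \<omega> m *v u)"
          using Cauchy_Schwarz_ineq2[of "b (shift (int m) \<omega>)" "Sprod \<omega> m *v u"] gm by (simp add: good_b_def)
        finally have "c * t * (s * q \<omega> u) \<le> c * t * norm (Sprod \<omega> m *v u)"
          using c t by (intro mult_left_mono) auto
        also have "\<dots> < c * norm (Sprod \<omega> m *v v)" using c m(1) by (simp add: mult.assoc)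
        also have "\<dots> \<le> s * q \<omega> v" using m(2) by (simp add: s good_b_q[OF elim(1)] good_b_q[OF gm])
        finally have "s * (c * t * q \<omega> u) < s * q \<omega> v" by (simp add: ac_simps)
        then show "\<omega> \<in> {\<omega>. c * t * q \<omega> u < q \<omega> v}" using s(1) by simp
      qed
    qed
    have "{\<omega>\<in>space P. c * t * q \<omega> u < q \<omega> v} \<in> sets P" by measurable
    then show "{\<omega>. c * t * q \<omega> u < q \<omega> v} \<in> sets P" by simp
  qed
  finally show ?thesis .
qed

text \<open>The maximal inequality is integrated over t by the layer-cake formula. A vanishing
  denominator is harmless: the ratio is then 0 and exceeds no t \<ge> 0, and
  \<open>q \<omega> u\<close> is almost surely positive.\<close>

lemma maximal_ratio_integral:
  assumes c: "c > 0" "\<And>w. w \<noteq> 0 \<Longrightarrow> c \<le> P.prob {\<omega>. c * norm w \<le> q \<omega> w}" and u: "u \<noteq> 0"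
  shows "(\<integral>\<^sup>+\<omega>. (SUP m. ennreal (norm (Sprod \<omega> m *v v) / norm (Sprod \<omega> m *v u))) \<partial>P)
    \<le> ennreal (1 / c) * (\<integral>\<^sup>+\<omega>. ennreal (q \<omega> v / (c * q \<omega> u)) \<partial>P)"
proof (rule P.nn_integral_le_if_tail_le)
  fix t :: real assume t: "0 \<le> t"
  have meas: "{\<omega>. \<exists>m. t * norm (Sprod \<omega> m *v u) < norm (Sprod \<omega> m *v v)} \<in> sets P"
  proof -
    have "{\<omega>\<in>space P. \<exists>m. t * norm (Sprod \<omega> m *v u) < norm (Sprod \<omega> m *v v)} \<in> sets P" by measurable
    then show ?thesis by simp
  qed
  have "emeasure P {\<omega>\<in>space P. ennreal t < (SUP m. ennreal (norm (Sprod \<omega> m *v v) / norm (Sprod \<omega> m *v u)))}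
    \<le> emeasure P {\<omega>. \<exists>m. t * norm (Sprod \<omega> m *v u) < norm (Sprod \<omega> m *v v)}"
  proof (rule emeasure_mono[OF _ meas], rule subsetI)
    fix \<omega> assume "\<omega> \<in> {\<omega>\<in>space P. ennreal t < (SUP m. ennreal (norm (Sprod \<omega> m *v v) / norm (Sprod \<omega> m *v u)))}"
    then obtain m where "ennreal t < ennreal (norm (Sprod \<omega> m *v v) / norm (Sprod \<omega> m *v u))"
      by (auto simp: less_SUP_iff)
    then have "t < norm (Sprod \<omega> m *v v) / norm (Sprod \<omega> m *v u)" using t by (simp add: ennreal_less_iff)
    then have "t * norm (Sprod \<omega> m *v u) < norm (Sprod \<omega> m *v v)"
      using t by (cases "Sprod \<omega> m *v u = 0") (auto simp: pos_less_divide_eq)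
    then show "\<omega> \<in> {\<omega>. \<exists>m. t * norm (Sprod \<omega> m *v u) < norm (Sprod \<omega> m *v v)}" by blast
  qed
  also have "\<dots> = ennreal (1 / c) * (ennreal c * emeasure P {\<omega>. \<exists>m. t * norm (Sprod \<omega> m *v u) < norm (Sprod \<omega> m *v v)})"
    using c(1) by (simp add: mult.assoc[symmetric] ennreal_mult[symmetric])
  also have "\<dots> \<le> ennreal (1 / c) * emeasure P {\<omega>. c * t * q \<omega> u < q \<omega> v}"
    by (intro mult_left_mono maximal_inequality[OF c t]) auto
  also have "emeasure P {\<omega>. c * t * q \<omega> u < q \<omega> v} \<le> emeasure P {\<omega>\<in>space P. ennreal t < ennreal (q \<omega> v / (c * q \<omega> u))}"
  proof (rule emeasure_mono_AE)
    show "AE \<omega> in P. \<omega> \<in> {\<omega>. c * t * q \<omega> u < q \<omega> v} \<longrightarrow> \<omega> \<in> {\<omega>\<in>space P. ennreal t < ennreal (q \<omega> v / (c * q \<omega> u))}"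
      using AE_good_b b_nonorthogonal[OF u]
    proof eventually_elim
      case (elim \<omega>)
      then have "c * q \<omega> u > 0" using c(1) by (simp add: good_b_q)
      then show ?case using t by (auto simp: ennreal_less_iff pos_less_divide_eq ac_simps)
    qed
  qed measurable
  finally show "emeasure P {\<omega>\<in>space P. ennreal t < (SUP m. ennreal (norm (Sprod \<omega> m *v v) / norm (Sprod \<omega> m *v u)))}
    \<le> ennreal (1 / c) * emeasure P {\<omega>\<in>space P. ennreal t < ennreal (q \<omega> v / (c * q \<omega> u))}"
    by (simp add: mult_left_mono)
qed measurable

section \<open>Integrability of the maximal ratio\<close>

lemma AE_xi:
  "AE \<omega> in P. xi z zt \<omega> = (b (shift 1 \<omega>) \<bullet> (Bcoef \<omega> 1 *v a \<omega>)) / (b (shift 1 \<omega>) \<bullet> (Acoef \<omega> 1 *v a \<omega>))"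
  using Z AE_shift[OF Zt, of 1]
  by eventually_elim (simp add: xi_def a_def b_def matrix_vector_mult_scaleR)

text \<open>Almost surely the supremum over m of the norm ratio of B a to A a after m further steps;
  written with \<open>p\<close> in order to be measurable.\<close>

definition max_ratio :: "(int \<Rightarrow> (real^'d^'d) \<times> (real^'d^'d)) \<Rightarrow> ennreal" where
  "max_ratio \<omega> = (SUP m. ennreal (p \<omega> (Sprod (shift 1 \<omega>) m ** Bcoef \<omega> 1) / p \<omega> (Sprod (shift 1 \<omega>) m ** Acoef \<omega> 1)))"

lemma max_ratio_measurable [measurable]: "max_ratio \<in> borel_measurable P"
  unfolding max_ratio_def by measurable

text \<open>Gluing at 1 freezes u = A a and v = B a while the later matrices stay independent of
  them, so \<open>maximal_ratio_integral\<close> applies to deterministic vectors. The ratio of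
  \<open>q\<close> at v and u is \<bar>\<xi>\<bar>, where the sign ambiguity of \<open>a\<close>
  disappears; the resulting bound is 1/c^2 times E\<bar>\<xi>\<bar>.\<close>

lemma max_ratio_finite:
  assumes int: "integrable P (xi z zt)"
  shows "(\<integral>\<^sup>+\<omega>. max_ratio \<omega> \<partial>P) < \<infinity>"
proof -
  have [measurable]: "xi z zt \<in> borel_measurable P" using int by simp
  obtain c where c: "c > 0" "\<And>w. w \<noteq> 0 \<Longrightarrow> c \<le> P.prob {\<omega>. c * norm w \<le> q \<omega> w}"
    using b_spread by blast
  have "(\<integral>\<^sup>+\<omega>. max_ratio \<omega> \<partial>P) = (\<integral>\<^sup>+\<omega>. (\<integral>\<^sup>+\<omega>'. max_ratio (glue 1 \<omega> \<omega>') \<partial>P) \<partial>P)"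
    by (rule nn_integral_glue) measurable
  also have "\<dots> \<le> (\<integral>\<^sup>+\<omega>. (\<integral>\<^sup>+\<omega>'. ennreal (1 / c) * ennreal (\<bar>xi z zt (glue 1 \<omega> \<omega>')\<bar> / c) \<partial>P) \<partial>P)"
  proof (rule nn_integral_mono_AE)
    have "AE \<omega> in P. good_a \<omega> \<and> good_b (shift 1 \<omega>) \<and>
        xi z zt \<omega> = (b (shift 1 \<omega>) \<bullet> (Bcoef \<omega> 1 *v a \<omega>)) / (b (shift 1 \<omega>) \<bullet> (Acoef \<omega> 1 *v a \<omega>))"
      using AE_good_a AE_shift[OF AE_good_b, of 1] AE_xi by eventually_elim simp
    from AE_glue[OF this, of 1] AE_good_a AE_invertible
    show "AE \<omega> in P. (\<integral>\<^sup>+\<omega>'. max_ratio (glue 1 \<omega> \<omega>') \<partial>P)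
      \<le> (\<integral>\<^sup>+\<omega>'. ennreal (1 / c) * ennreal (\<bar>xi z zt (glue 1 \<omega> \<omega>')\<bar> / c) \<partial>P)"
    proof eventually_elim
      case (elim \<omega>)
      define u where "u = Acoef \<omega> 1 *v a \<omega>"
      define v where "v = Bcoef \<omega> 1 *v a \<omega>"
      have "a \<omega> \<noteq> 0" using elim(2) by (auto simp: good_a_def)
      then have u: "u \<noteq> 0" using elim(3) invertible_mult_vec_eq_0[of "Acoef \<omega> 1" "a \<omega>"] by (simp add: u_def Acoef_def)
      have coef: "Acoef (glue 1 \<omega> \<omega>') 1 = Acoef \<omega> 1" "Bcoef (glue 1 \<omega> \<omega>') 1 = Bcoef \<omega> 1" for \<omega>'
        by (simp_all add: Acoef_def Bcoef_def)
      have mr: "max_ratio (glue 1 \<omega> \<omega>') =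
          (SUP m. ennreal (norm (Sprod (shift 1 \<omega>') m *v v) / norm (Sprod (shift 1 \<omega>') m *v u)))" for \<omega>'
        unfolding max_ratio_def
        by (simp add: Sprod_shift_glue p_glue coef good_a_p[OF elim(2)] u_def v_def matrix_vector_mul_assoc)
      have "(\<integral>\<^sup>+\<omega>'. max_ratio (glue 1 \<omega> \<omega>') \<partial>P)
        = (\<integral>\<^sup>+\<omega>'. (SUP m. ennreal (norm (Sprod \<omega>' m *v v) / norm (Sprod \<omega>' m *v u))) \<partial>P)"
        unfolding mr by (rule nn_integral_shift) measurable
      also have "\<dots> \<le> ennreal (1 / c) * (\<integral>\<^sup>+\<omega>'. ennreal (q \<omega>' v / (c * q \<omega>' u)) \<partial>P)"
        by (rule maximal_ratio_integral[OF c u])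
      also have "(\<integral>\<^sup>+\<omega>'. ennreal (q \<omega>' v / (c * q \<omega>' u)) \<partial>P)
        = (\<integral>\<^sup>+\<omega>'. ennreal (q (shift 1 \<omega>') v / (c * q (shift 1 \<omega>') u)) \<partial>P)"
        by (rule nn_integral_shift[symmetric]) measurable
      also have "\<dots> = (\<integral>\<^sup>+\<omega>'. ennreal (\<bar>xi z zt (glue 1 \<omega> \<omega>')\<bar> / c) \<partial>P)"
      proof (rule nn_integral_cong_AE)
        show "AE \<omega>' in P. ennreal (q (shift 1 \<omega>') v / (c * q (shift 1 \<omega>') u)) = ennreal (\<bar>xi z zt (glue 1 \<omega> \<omega>')\<bar> / c)"
          using elim(1)
        proof eventually_elim
          case g: (elim \<omega>')
          let ?b = "b (shift 1 (glue 1 \<omega> \<omega>'))"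
          have qb: "q (shift 1 \<omega>') w = \<bar>?b \<bullet> w\<bar>" for w
            using g good_b_q q_shift_glue by metis
          have ga: "a (glue 1 \<omega> \<omega>') = a \<omega> \<or> a (glue 1 \<omega> \<omega>') = - a \<omega>"
            using g elim(2) by (intro a_glue) auto
          have neg: "M *v (- a \<omega>) = - (M *v a \<omega>)" for M :: "real^'d^'d"
            using matrix_vector_mult_scaleR[of M "-1" "a \<omega>"] by simp
          have "\<bar>xi z zt (glue 1 \<omega> \<omega>')\<bar> = \<bar>?b \<bullet> v\<bar> / \<bar>?b \<bullet> u\<bar>"
            using g ga by (auto simp: coef u_def v_def neg abs_divide)
          then show ?case using c(1) by (simp add: qb field_simps)
        qed
      qed
      also have "ennreal (1 / c) * (\<integral>\<^sup>+\<omega>'. ennreal (\<bar>xi z zt (glue 1 \<omega> \<omega>')\<bar> / c) \<partial>P)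
        = (\<integral>\<^sup>+\<omega>'. ennreal (1 / c) * ennreal (\<bar>xi z zt (glue 1 \<omega> \<omega>')\<bar> / c) \<partial>P)"
        by (rule nn_integral_cmult[symmetric]) measurable
      finally show ?case by (auto intro: mult_left_mono)
    qed
  qed
  also have "\<dots> = (\<integral>\<^sup>+\<omega>. ennreal (1 / c) * ennreal (\<bar>xi z zt \<omega>\<bar> / c) \<partial>P)"
    by (rule nn_integral_glue[symmetric]) measurable
  also have "\<dots> = (\<integral>\<^sup>+\<omega>. ennreal (norm ((1 / c * (1 / c)) * xi z zt \<omega>)) \<partial>P)"
    using c(1) by (intro nn_integral_cong) (simp add: ennreal_mult[symmetric] abs_mult)
  also have "\<dots> < \<infinity>"
    using integrable_mult_right[OF int, of "1 / c * (1 / c)"] unfolding integrable_iff_bounded by blast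
  finally show ?thesis .
qed

text \<open>\<open>a\<close> depends on the past up to sign and \<open>b\<close> on the future, so
  by Fubini the claim reduces to \<open>b_nonorthogonal\<close> for a fixed vector. The function
  \<open>r\<close> is a measurable stand-in for \<bar>b \<bullet> a\<bar>.\<close>

lemma b_a_nonorthogonal: "AE \<omega> in P. b \<omega> \<bullet> a \<omega> \<noteq> 0"
proof -
  define r where "r \<omega> = lim (\<lambda>n. p \<omega> (Sprod \<omega> n) / norm (Sprod \<omega> n))" for \<omega>
  have rm [measurable]: "r \<in> borel_measurable P" unfolding r_def by measurable
  have R: "{\<omega>. r \<omega> = 0} \<in> sets P"
  proof -
    have "{\<omega>\<in>space P. r \<omega> = 0} \<in> sets P" by measurable
    then show ?thesis by simp
  qed
  have "emeasure P {\<omega>. r \<omega> = 0} = (\<integral>\<^sup>+\<omega>. emeasure P {\<omega>'. r (glue 0 \<omega> \<omega>') = 0} \<partial>P)"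
    by (rule emeasure_glue[OF R])
  also have "\<dots> = (\<integral>\<^sup>+\<omega>. 0 \<partial>P)"
  proof (rule nn_integral_cong_AE)
    show "AE \<omega> in P. emeasure P {\<omega>'. r (glue 0 \<omega> \<omega>') = 0} = 0"
      using AE_good_a
    proof eventually_elim
      case (elim \<omega>)
      have a0: "a \<omega> \<noteq> 0" using elim by (auto simp: good_a_def)
      have eq: "r (glue 0 \<omega> \<omega>') = q \<omega>' (a \<omega>)" for \<omega>'
        using Sprod_shift_glue[of 0 \<omega> \<omega>']
        by (simp add: r_def q_def p_glue good_a_p[OF elim])
      have "AE \<omega>' in P. q \<omega>' (a \<omega>) \<noteq> 0"
        using AE_good_b b_nonorthogonal[OF a0] by eventually_elim (simp add: good_b_q)
      moreover have "{\<omega>'\<in>space P. q \<omega>' (a \<omega>) = 0} \<in> sets P" by measurable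
      ultimately show ?case unfolding eq
        by (subst (asm) AE_iff_measurable[of "{\<omega>'. q \<omega>' (a \<omega>) = 0}"]) auto
    qed
  qed
  finally have "emeasure P {\<omega>. r \<omega> = 0} = 0" by simp
  then have "AE \<omega> in P. r \<omega> \<noteq> 0" using R by (subst AE_iff_measurable[of "{\<omega>. r \<omega> = 0}"]) auto
  then show ?thesis
    using AE_good_a AE_good_b
  proof eventually_elim
    case (elim \<omega>)
    have "r \<omega> = q \<omega> (a \<omega>)" by (simp add: r_def q_def good_a_p[OF elim(2)])
    then show ?case using elim(1) by (simp add: good_b_q[OF elim(3)])
  qed
qed

section \<open>The limit of the norm ratio\<close>


text \<open>Normalized by \<open>norm (Sprod \<omega> n)\<close>, not by the norm of the image of
  \<open>v\<close>, so that it is a seminorm in \<open>v\<close>; this makes the vectors with limit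
  0 a subspace.\<close>

definition defect :: "real \<Rightarrow> (int \<Rightarrow> (real^'d^'d) \<times> (real^'d^'d)) \<Rightarrow> real^'d \<Rightarrow> nat \<Rightarrow> real" where
  "defect e \<omega> v n = norm ((1 / real n) *\<^sub>R (Tprod \<omega> n *v v) - e *\<^sub>R (Sprod \<omega> n *v v)) / norm (Sprod \<omega> n)"

text \<open>Size of the term with index \<open>k\<close>, \<open>m = n - k - 1\<close>, in the expansion of
  \<open>T\<^sub>n a - (\<Sum>k<n. \<xi>\<^sub>k) S\<^sub>n a\<close> relative to \<open>S\<^sub>n a\<close>, transported to time 0.\<close>

definition relative_term :: "nat \<Rightarrow> (int \<Rightarrow> (real^'d^'d) \<times> (real^'d^'d)) \<Rightarrow> real" where
  "relative_term m \<omega> = \<bar>p \<omega> (Sprod (shift 1 \<omega>) m ** (Bcoef \<omega> 1 - xi z zt \<omega> *\<^sub>R Acoef \<omega> 1))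
      / p \<omega> (Sprod (shift 1 \<omega>) m ** Acoef \<omega> 1)\<bar>"

lemma relative_term_eq:
  assumes "good_a \<omega>"
  shows "relative_term m \<omega> = norm (Sprod (shift 1 \<omega>) m *v ((Bcoef \<omega> 1 - xi z zt \<omega> *\<^sub>R Acoef \<omega> 1) *v a \<omega>))
    / norm (Sprod (shift 1 \<omega>) m *v (Acoef \<omega> 1 *v a \<omega>))"
  by (simp add: relative_term_def good_a_p[OF assms] matrix_vector_mul_assoc)

text \<open>Numerator and denominator are divided by the norm of the product. The first then tends
  to 0, since \<xi> makes B a - \<xi> A a orthogonal to the next \<open>b\<close>; the second has a
  nonzero limit by \<open>b_a_nonorthogonal\<close> and \<open>b_step\<close>.\<close>

lemma relative_term_tendsto_0: "AE \<omega> in P. (\<lambda>m. relative_term m \<omega>) \<longlonglongrightarrow> 0"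
  using AE_good_a AE_good_b AE_shift[OF AE_good_b, of 1] AE_invertible AE_xi b_a_nonorthogonal
proof eventually_elim
  case (elim \<omega>)
  let ?b = "b (shift 1 \<omega>)" and ?S = "Sprod (shift 1 \<omega>)"
  let ?u = "Acoef \<omega> 1 *v a \<omega>" and ?v = "(Bcoef \<omega> 1 - xi z zt \<omega> *\<^sub>R Acoef \<omega> 1) *v a \<omega>"
  have u: "?b \<bullet> ?u \<noteq> 0" using b_step[OF elim(2,3,4)] elim(6) by simp
  have v: "?b \<bullet> ?v = 0"
    using u by (simp add: elim(5) matrix_vector_mult_diff_rdistrib scaleR_mult_vec inner_diff_right)
  have inv: "\<forall>i. invertible (fst (shift 1 \<omega> i))" using elim(4) by (simp add: shift_def)
  have "(\<lambda>m. (norm (?S m *v ?v) / norm (?S m)) / (norm (?S m *v ?u) / norm (?S m))) \<longlonglongrightarrow> \<bar>?b \<bullet> ?v\<bar> / \<bar>?b \<bullet> ?u\<bar>"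
    using elim(3) u unfolding good_b_def by (intro tendsto_divide) auto
  moreover have "(norm (?S m *v ?v) / norm (?S m)) / (norm (?S m *v ?u) / norm (?S m)) = relative_term m \<omega>" for m
    by (cases "?S m = 0") (auto simp: relative_term_eq[OF elim(1)])
  ultimately show ?case using v by simp
qed

lemma relative_term_le:
  assumes int: "integrable P (xi z zt)"
  shows "AE \<omega> in P. \<forall>m. relative_term m \<omega> \<le> enn2real (max_ratio \<omega>) + \<bar>xi z zt \<omega>\<bar>"
proof -
  \<comment> \<open>\<open>enn2real\<close> sends infinity to 0, so the bound requires finiteness
    first.\<close>
  have "AE \<omega> in P. max_ratio \<omega> \<noteq> \<infinity>"
    using max_ratio_finite[OF int] by (intro nn_integral_noteq_infinite) auto
  then show ?thesis
    using AE_good_a AE_invertible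
  proof eventually_elim
    case (elim \<omega>)
    let ?S = "Sprod (shift 1 \<omega>)"
    let ?u = "Acoef \<omega> 1 *v a \<omega>" and ?w = "Bcoef \<omega> 1 *v a \<omega>"
    have "relative_term m \<omega> \<le> enn2real (max_ratio \<omega>) + \<bar>xi z zt \<omega>\<bar>" for m
    proof -
      have "ennreal (norm (?S m *v ?w) / norm (?S m *v ?u)) \<le> max_ratio \<omega>"
        unfolding max_ratio_def
        by (rule SUP_upper2[of m]) (simp_all add: good_a_p[OF elim(2)] matrix_vector_mul_assoc)
      then have r: "norm (?S m *v ?w) / norm (?S m *v ?u) \<le> enn2real (max_ratio \<omega>)"
        using enn2real_mono[of _ "max_ratio \<omega>"] elim(1) by (fastforce simp: less_top)
      have "?S m *v ((Bcoef \<omega> 1 - xi z zt \<omega> *\<^sub>R Acoef \<omega> 1) *v a \<omega>) = ?S m *v ?w - xi z zt \<omega> *\<^sub>R (?S m *v ?u)"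
        by (simp add: matrix_vector_mult_diff_rdistrib scaleR_mult_vec matrix_vector_mult_diff_distrib matrix_vector_mult_scaleR)
      then have "relative_term m \<omega> \<le> (norm (?S m *v ?w) + \<bar>xi z zt \<omega>\<bar> * norm (?S m *v ?u)) / norm (?S m *v ?u)"
        unfolding relative_term_eq[OF elim(2)]
        using norm_triangle_ineq4[of "?S m *v ?w" "xi z zt \<omega> *\<^sub>R (?S m *v ?u)"] by (intro divide_right_mono) auto
      also have "\<dots> \<le> norm (?S m *v ?w) / norm (?S m *v ?u) + \<bar>xi z zt \<omega>\<bar>"
        by (simp add: add_divide_distrib)
      finally show ?thesis using r by simp
    qed
    then show ?case by blast
  qed
qed

text \<open>S_k a is a scalar multiple of \<open>a\<close> at the point shifted by k, and the same
  scalar appears in S_n a; it cancels in the relative size of each summand of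
  \<open>Tprod_minus_Sprod_sum\<close>.\<close>

lemma norm_remainder_le:
  assumes good: "\<And>k. good_a (shift (int k) \<omega>)" and inv: "\<forall>i. invertible (fst (\<omega> i))"
  shows "norm (Tprod \<omega> n *v a \<omega> - (\<Sum>k<n. xi z zt (shift (int k) \<omega>)) *\<^sub>R (Sprod \<omega> n *v a \<omega>))
    \<le> (\<Sum>k<n. relative_term (n - Suc k) (shift (int k) \<omega>)) * norm (Sprod \<omega> n *v a \<omega>)"
proof -
  let ?\<omega> = "\<lambda>k. shift (int k) \<omega>"
  let ?t = "\<lambda>k. Sprod (shift (int (Suc k)) \<omega>) (n - Suc k) *v
       ((Bcoef \<omega> (int (Suc k)) - xi z zt (?\<omega> k) *\<^sub>R Acoef \<omega> (int (Suc k))) *v (Sprod \<omega> k *v a \<omega>))"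
  have g0: "good_a \<omega>" using good[of 0] by simp
  have "norm (?t k) = relative_term (n - Suc k) (?\<omega> k) * norm (Sprod \<omega> n *v a \<omega>)" if k: "k < n" for k
  proof -
    obtain s where s: "Sprod \<omega> k *v a \<omega> = s *\<^sub>R a (?\<omega> k)"
      using a_cocycle[OF g0 good inv] by blast
    let ?S = "Sprod (shift 1 (?\<omega> k)) (n - Suc k)"
    have coef: "Acoef \<omega> (int (Suc k)) = Acoef (?\<omega> k) 1" "Bcoef \<omega> (int (Suc k)) = Bcoef (?\<omega> k) 1"
      by (simp_all add: Acoef_shift Bcoef_shift)
    have sh: "shift (int (Suc k)) \<omega> = shift 1 (?\<omega> k)" by simp
    have "Sprod \<omega> n = ?S ** (Acoef (?\<omega> k) 1 ** Sprod \<omega> k)"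
      using Sprod_add[of \<omega> "n - Suc k" "Suc k"] k by (simp add: coef[symmetric] del: of_nat_Suc) simp
    then have Sn: "Sprod \<omega> n *v a \<omega> = s *\<^sub>R (?S *v (Acoef (?\<omega> k) 1 *v a (?\<omega> k)))"
      by (simp add: matrix_vector_mul_assoc[symmetric] s matrix_vector_mult_scaleR)
    have tk: "?t k = s *\<^sub>R (?S *v ((Bcoef (?\<omega> k) 1 - xi z zt (?\<omega> k) *\<^sub>R Acoef (?\<omega> k) 1) *v a (?\<omega> k)))"
      unfolding coef sh s by (simp add: matrix_vector_mult_scaleR)
    have "invertible ?S" "invertible (Acoef (?\<omega> k) 1)"
      using inv by (auto intro!: invertible_Sprod simp: shift_def Acoef_def)
    moreover have "a (?\<omega> k) \<noteq> 0" using good[of k] by (auto simp: good_a_def)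
    ultimately have "norm (?S *v (Acoef (?\<omega> k) 1 *v a (?\<omega> k))) \<noteq> 0"
      by (simp add: invertible_mult_vec_eq_0)
    then show ?thesis unfolding tk Sn relative_term_eq[OF good] by simp
  qed
  then have "(\<Sum>k<n. norm (?t k)) = (\<Sum>k<n. relative_term (n - Suc k) (?\<omega> k)) * norm (Sprod \<omega> n *v a \<omega>)"
    by (simp add: sum_distrib_right)
  moreover have "norm (\<Sum>k<n. ?t k) \<le> (\<Sum>k<n. norm (?t k))" by (rule norm_sum)
  ultimately show ?thesis unfolding Tprod_minus_Sprod_sum by simp
qed

lemma defect_a_tendsto_0:
  assumes int: "integrable P (xi z zt)"
  shows "AE \<omega> in P. defect (P.expectation (xi z zt)) \<omega> (a \<omega>) \<longlonglongrightarrow> 0"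
proof -
  let ?E = "P.expectation (xi z zt)"
  have [measurable]: "xi z zt \<in> borel_measurable P" using int by simp
  have rm: "relative_term m \<in> borel_measurable P" for m
    unfolding relative_term_def by measurable
  have "integrable P (\<lambda>\<omega>. enn2real (max_ratio \<omega>))"
  proof (rule integrableI_bounded)
    have "(\<integral>\<^sup>+\<omega>. ennreal (norm (enn2real (max_ratio \<omega>))) \<partial>P) \<le> (\<integral>\<^sup>+\<omega>. max_ratio \<omega> \<partial>P)"
      by (intro nn_integral_mono) (simp add: ennreal_enn2real_if)
    then show "(\<integral>\<^sup>+\<omega>. ennreal (norm (enn2real (max_ratio \<omega>))) \<partial>P) < \<infinity>"
      using max_ratio_finite[OF int] by (rule le_less_trans)
  qed measurable
  then have G: "integrable P (\<lambda>\<omega>. enn2real (max_ratio \<omega>) + \<bar>xi z zt \<omega>\<bar>)" using int by simp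
  have "AE \<omega> in P. (\<lambda>n. (\<Sum>k<n. relative_term (n - Suc k) (shift (int k) \<omega>)) / real n) \<longlonglongrightarrow> 0"
    using erg.diagonal_average_tendsto_0[OF rm _ relative_term_tendsto_0 relative_term_le[OF int] G]
    by (simp add: shift_funpow relative_term_def)
  moreover have "AE \<omega> in P. (\<lambda>n. (\<Sum>k<n. xi z zt (shift (int k) \<omega>)) / real n) \<longlonglongrightarrow> ?E"
    using erg.birkhoff[OF int] by (simp add: shift_funpow)
  ultimately show ?thesis
    using AE_shift_nat[OF AE_good_a] AE_good_b AE_invertible
  proof eventually_elim
    case (elim \<omega>)
    define x where "x n = (\<Sum>k<n. xi z zt (shift (int k) \<omega>))" for n
    define g where "g n = (\<Sum>k<n. relative_term (n - Suc k) (shift (int k) \<omega>))" for n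
    let ?S = "\<lambda>n. Sprod \<omega> n *v a \<omega>" and ?T = "\<lambda>n. Tprod \<omega> n *v a \<omega>"
    have "(\<lambda>n. (g n / real n + \<bar>x n / real n - ?E\<bar>) * (norm (?S n) / norm (Sprod \<omega> n))) \<longlonglongrightarrow> (0 + \<bar>?E - ?E\<bar>) * \<bar>b \<omega> \<bullet> a \<omega>\<bar>"
      using elim(1,2,4) unfolding good_b_def g_def[symmetric] x_def[symmetric]
      by (intro tendsto_intros) auto
    then have lim: "(\<lambda>n. (g n / real n + \<bar>x n / real n - ?E\<bar>) * (norm (?S n) / norm (Sprod \<omega> n))) \<longlonglongrightarrow> 0" by simp
    have le: "defect ?E \<omega> (a \<omega>) n \<le> (g n / real n + \<bar>x n / real n - ?E\<bar>) * (norm (?S n) / norm (Sprod \<omega> n))" for n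
    proof -
      have "(1 / real n) *\<^sub>R ?T n - ?E *\<^sub>R ?S n = (1 / real n) *\<^sub>R (?T n - x n *\<^sub>R ?S n) + (x n / real n - ?E) *\<^sub>R ?S n"
        by (simp add: algebra_simps)
      then have "norm ((1 / real n) *\<^sub>R ?T n - ?E *\<^sub>R ?S n)
        \<le> (1 / real n) * norm (?T n - x n *\<^sub>R ?S n) + \<bar>x n / real n - ?E\<bar> * norm (?S n)"
        using norm_triangle_ineq[of "(1 / real n) *\<^sub>R (?T n - x n *\<^sub>R ?S n)" "(x n / real n - ?E) *\<^sub>R ?S n"] by simp
      also have "\<dots> \<le> (1 / real n) * (g n * norm (?S n)) + \<bar>x n / real n - ?E\<bar> * norm (?S n)"
        unfolding x_def g_def using elim(3,5)
        by (intro add_right_mono mult_left_mono norm_remainder_le) auto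
      also have "\<dots> = (g n / real n + \<bar>x n / real n - ?E\<bar>) * norm (?S n)" by (simp add: algebra_simps)
      finally show ?thesis unfolding defect_def times_divide_eq_right by (intro divide_right_mono) auto
    qed
    show ?case
      by (rule tendsto_sandwich[OF _ _ tendsto_const lim]) (use le in \<open>auto simp: defect_def\<close>)
  qed
qed

section \<open>From the random direction to all vectors\<close>

lemma subspace_defect: "subspace {v. defect e \<omega> v \<longlonglongrightarrow> 0}"
  unfolding subspace_def
proof (intro conjI ballI allI)
  let ?r = "\<lambda>v n. (1 / real n) *\<^sub>R (Tprod \<omega> n *v v) - e *\<^sub>R (Sprod \<omega> n *v v)"
  have "defect e \<omega> 0 = (\<lambda>n. 0)" by (simp add: defect_def fun_eq_iff)
  then show "0 \<in> {v. defect e \<omega> v \<longlonglongrightarrow> 0}" by simp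
  fix v assume v: "v \<in> {v. defect e \<omega> v \<longlonglongrightarrow> 0}"
  {
    fix w assume w: "w \<in> {v. defect e \<omega> v \<longlonglongrightarrow> 0}"
    have lim: "(\<lambda>n. defect e \<omega> v n + defect e \<omega> w n) \<longlonglongrightarrow> 0"
      using tendsto_add[of "defect e \<omega> v" 0 _ "defect e \<omega> w" 0] v w by simp
    have le: "defect e \<omega> (v + w) n \<le> defect e \<omega> v n + defect e \<omega> w n" for n
    proof -
      have "?r (v + w) n = ?r v n + ?r w n" by (simp add: matrix_vector_right_distrib algebra_simps)
      then have "norm (?r (v + w) n) \<le> norm (?r v n) + norm (?r w n)" using norm_triangle_ineq by metis
      then show ?thesis unfolding defect_def add_divide_distrib[symmetric] by (intro divide_right_mono) auto
    qed
    have "defect e \<omega> (v + w) \<longlonglongrightarrow> 0"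
      by (rule tendsto_sandwich[OF _ _ tendsto_const lim]) (use le in \<open>auto simp: defect_def\<close>)
    then show "v + w \<in> {v. defect e \<omega> v \<longlonglongrightarrow> 0}" by simp
  }
  fix c
  have "?r (c *\<^sub>R v) n = c *\<^sub>R ?r v n" for n by (simp add: matrix_vector_mult_scaleR algebra_simps)
  then have "defect e \<omega> (c *\<^sub>R v) = (\<lambda>n. \<bar>c\<bar> * defect e \<omega> v n)"
    unfolding defect_def fun_eq_iff by simp
  then show "c *\<^sub>R v \<in> {v. defect e \<omega> v \<longlonglongrightarrow> 0}" using v by (simp add: tendsto_mult_right_zero)
qed

text \<open>The products from time 0 on do not change when the past is resampled. So for almost
  every future the subspace of vectors with vanishing defect is fixed and contains \<open>a\<close>
  for almost every past; a proper one would confine \<open>a\<close> to a hyperplane.\<close>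

lemma defect_tendsto_0:
  assumes int: "integrable P (xi z zt)"
  shows "AE \<omega> in P. \<forall>v. defect (P.expectation (xi z zt)) \<omega> v \<longlonglongrightarrow> 0"
proof -
  let ?d = "defect (P.expectation (xi z zt))"
  have "AE \<omega> in P. good_a \<omega> \<and> ?d \<omega> (a \<omega>) \<longlonglongrightarrow> 0"
    using AE_good_a defect_a_tendsto_0[OF int] by eventually_elim simp
  from AE_glue_swap[OF this, of 0]
  show ?thesis
  proof eventually_elim
    case (elim \<omega>')
    let ?L = "{v. ?d \<omega>' v \<longlonglongrightarrow> 0}"
    have sub: "subspace ?L" by (rule subspace_defect)
    have L: "AE \<omega> in P. a \<omega> \<in> ?L"
      using elim AE_good_a
    proof eventually_elim
      case (elim \<omega>)
      have "Sprod (glue 0 \<omega> \<omega>') n = Sprod \<omega>' n" "Tprod (glue 0 \<omega> \<omega>') n = Tprod \<omega>' n" for n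
        by (auto intro!: Sprod_cong Tprod_cong)
      then have "?d (glue 0 \<omega> \<omega>') = ?d \<omega>'" by (simp add: defect_def fun_eq_iff)
      then have "a (glue 0 \<omega> \<omega>') \<in> ?L" using elim(1) by simp
      moreover have "a (glue 0 \<omega> \<omega>') = a \<omega> \<or> a (glue 0 \<omega> \<omega>') = - a \<omega>"
        using elim by (intro a_glue) auto
      ultimately show ?case using subspace_neg[OF sub, of "- a \<omega>"] by auto
    qed
    have "?L = UNIV"
    proof (rule ccontr)
      assume "?L \<noteq> UNIV"
      then have "span ?L \<subset> UNIV" using span_eq_iff sub by (metis psubsetI subset_UNIV)
      then obtain y where y: "y \<noteq> 0" "\<And>v. v \<in> span ?L \<Longrightarrow> orthogonal y v"
        using orthogonal_to_subspace_exists_gen[of ?L UNIV] by (metis span_UNIV)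
      have "AE \<omega> in P. a \<omega> \<bullet> y = 0"
        using L
      proof eventually_elim
        case (elim \<omega>)
        from y(2)[OF span_base[OF elim]] show ?case by (simp add: orthogonal_def inner_commute)
      qed
      with a_not_in_hyperplane[OF y(1)] show False by simp
    qed
    then show ?case by blast
  qed
qed

text \<open>The normalization changes from the norm of S_n to that of S_n x; their quotient tends to
  \<bar>b \<bullet> x\<bar>, which is almost surely not 0. The reverse triangle inequality then
  passes from vectors to norms.\<close>

theorem norm_ratio_tendsto:
  assumes int: "integrable P (xi z zt)" and x: "x \<noteq> 0"
  shows "AE \<omega> in P. (\<lambda>n. (1 / real n) * (norm (Tprod \<omega> n *v x) / norm (Sprod \<omega> n *v x)))
    \<longlonglongrightarrow> \<bar>P.expectation (xi z zt)\<bar>"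
  using defect_tendsto_0[OF int] AE_good_b b_nonorthogonal[OF x] AE_invertible
proof eventually_elim
  case (elim \<omega>)
  let ?E = "P.expectation (xi z zt)"
  let ?S = "\<lambda>n. Sprod \<omega> n *v x" and ?T = "\<lambda>n. Tprod \<omega> n *v x"
  have S0: "?S n \<noteq> 0" for n
    using invertible_mult_vec_eq_0[OF invertible_Sprod] elim(4) x by blast
  then have S1: "norm (Sprod \<omega> n) \<noteq> 0" for n by (metis matrix_vector_mult_0 norm_eq_zero)
  have "(\<lambda>n. defect ?E \<omega> x n / (norm (?S n) / norm (Sprod \<omega> n))) \<longlonglongrightarrow> 0 / \<bar>b \<omega> \<bullet> x\<bar>"
    using elim by (intro tendsto_divide) (auto simp: good_b_def)
  then have lim: "(\<lambda>n. norm ((1 / real n) *\<^sub>R ?T n - ?E *\<^sub>R ?S n) / norm (?S n)) \<longlonglongrightarrow> 0"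
    using S1 by (simp add: defect_def)
  have "\<bar>(1 / real n) * (norm (?T n) / norm (?S n)) - \<bar>?E\<bar>\<bar> \<le> norm ((1 / real n) *\<^sub>R ?T n - ?E *\<^sub>R ?S n) / norm (?S n)" for n
  proof -
    have "(1 / real n) * (norm (?T n) / norm (?S n)) - \<bar>?E\<bar>
      = (norm ((1 / real n) *\<^sub>R ?T n) - norm (?E *\<^sub>R ?S n)) / norm (?S n)"
      using S0[of n] by (simp add: diff_divide_distrib)
    then have "\<bar>(1 / real n) * (norm (?T n) / norm (?S n)) - \<bar>?E\<bar>\<bar>
      = \<bar>norm ((1 / real n) *\<^sub>R ?T n) - norm (?E *\<^sub>R ?S n)\<bar> / norm (?S n)" by (simp add: abs_divide)
    also have "\<dots> \<le> norm ((1 / real n) *\<^sub>R ?T n - ?E *\<^sub>R ?S n) / norm (?S n)"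
      by (intro divide_right_mono norm_triangle_ineq3) auto
    finally show ?thesis .
  qed
  then have "(\<lambda>n. (1 / real n) * (norm (?T n) / norm (?S n)) - \<bar>?E\<bar>) \<longlonglongrightarrow> 0"
    by (intro Lim_null_comparison[OF _ lim]) auto
  then show ?case by (simp add: LIM_zero_iff)
qed

end

theorem theorem8p4:
  fixes lam :: "((real^'d::finite^'d) \<times> (real^'d^'d)) measure"
    and z zt :: "(int \<Rightarrow> (real^'d^'d) \<times> (real^'d^'d)) \<Rightarrow> real^'d"
    and x :: "real^'d"
  defines "P \<equiv> PiM (UNIV :: int set) (\<lambda>_. lam)"
  assumes prob: "prob_space lam" and sets_borel: "sets lam = sets borel"
    and GL: "AE p in lam. invertible (fst p)"
    and irr: "strongly_irreducible (law_A lam)"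
    and contr: "contracting (law_A lam)"
    and fe2: "FE2 lam" and fe4: "FE4 lam"
    and Z: "AE \<omega> in P. z \<omega> \<noteq> 0 \<and>
              rank_one_limits_with_range (\<lambda>n. (1 / norm (Sprod (shift (- int n) \<omega>) n)) *\<^sub>R Sprod (shift (- int n) \<omega>) n) (z \<omega>)"
    and Zt: "AE \<omega> in P. zt \<omega> \<noteq> 0 \<and>
              rank_one_limits_with_range (\<lambda>n. (1 / norm (Sstar \<omega> n)) *\<^sub>R Sstar \<omega> n) (zt \<omega>)"
    and Exi: "prob_space.expectation P (xi z zt) \<noteq> 0"
    and x: "x \<noteq> 0"
  shows "AE \<omega> in P. (\<lambda>n. (1 / real n) * (norm (Tprod \<omega> n *v x) / norm (Sprod \<omega> n *v x)))
                       \<longlonglongrightarrow> \<bar>prob_space.expectation P (xi z zt)\<bar>"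
proof -
  interpret iid: iid_sequence lam
  proof (rule iid_sequence.intro)
    show "prob_space lam" by (rule prob)
    show "space lam = UNIV" using sets_eq_imp_space_eq[OF sets_borel] by simp
  qed
  have P: "iid.P = P" unfolding P_def by (rule iid.P_def)
  interpret mc: matrix_cocycle lam z zt
  proof (intro matrix_cocycle.intro matrix_cocycle_axioms.intro)
    show "iid_sequence lam" by (rule iid.iid_sequence_axioms)
    show "sets lam = sets borel" by (rule sets_borel)
    show "AE p in lam. invertible (fst p)" by (rule GL)
    show "strongly_irreducible (law_A lam)" by (rule irr)
  qed (use Z Zt in \<open>simp_all only: P\<close>)
  \<comment> \<open>The Bochner integral of a nonintegrable function is 0 by convention, so the
    nonzero expectation yields integrability.\<close>
  have int: "integrable P (xi z zt)"
  proof (rule ccontr)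
    assume "\<not> ?thesis"
    with Exi show False by (simp add: not_integrable_integral_eq)
  qed
  show ?thesis using mc.norm_ratio_tendsto[OF _ x] int by (simp only: P)
qed

end
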